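(* Let $\mathbf k\in(\mathbb N\cup\{\infty\})^\ell$. The ideal $\mathcal I\mathcal O^{\mathbf k}\subseteq\mathrm{NSym}^{(\ell)}$ is the two-sided ideal generated by $\{\Upsilon_{\mathbf n}:\mathbf 0<\mathbf n\le\mathbf k,\ |\mathbf n|\text{ even}\}$, and $\mathcal O^{\mathbf k}\subseteq\mathrm{QSym}^{(\ell)}$ is the $\mathbb Q$-span of those $\eta_{(\mathbf i_1,\dots,\mathbf i_m)}$ such that for every $r$, $\mathbf i_r\le\mathbf k$ implies $|\mathbf i_r|$ odd.
   Context: Fix $\ell\ge1$; $|\mathbf n|=\sum n_i$, coordinatewise order on $(\mathbb N\cup\{\infty\})^\ell$. Vector composition: sequence $\mathbf I=(\mathbf i_1,\dots,\mathbf i_m)$ of nonzero elements of $\mathbb N^\ell$, $\mathrm{len}(\mathbf I)=m$. $\mathbf J\trianglelefteq\mathbf I$ means $\mathbf J$ is obtained from $\mathbf I$ by adding together groups of consecutive columns. $\mathrm{QSym}^{(\ell)}$ is the $\mathbb Q$-span of $M_{\mathbf I}=\sum_{j_1<\dots<j_m}\mathbf x_{j_1}^{\mathbf i_1}\cdots\mathbf x_{j_m}^{\mathbf i_m}$ in commuting variables $x_j^{(i)}$ ($\mathbf x_j^{\mathbf n}=\prod_i(x_j^{(i)})^{n_i}$), a graded Hopf algebra with product of power series and deconcatenation coproduct; $\mathrm{NSym}^{(\ell)}$ is its graded dual. $\eta_{\mathbf I}=\sum_{\mathbf J\trianglelefteq\mathbf I}2^{\mathrm{len}(\mathbf J)}M_{\mathbf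 J}$ is a basis of $\mathrm{QSym}^{(\ell)}$, $(\Upsilon^{\mathbf I})$ is the dual basis of $\mathrm{NSym}^{(\ell)}$, and $\Upsilon_{\mathbf n}=\Upsilon^{(\mathbf n)}$. $\zeta_{\mathcal Q}(M_{\mathbf I})=1$ if $\mathrm{len}(\mathbf I)\le1$, else $0$; $\bar\zeta_{\mathcal Q}(h)=(-1)^{|\mathbf n|}\zeta_{\mathcal Q}(h)$ on degree $\mathbf n$; $\zeta_{\mathcal Q}^{-1}$ the convolution inverse. $\mathcal I\mathcal O^{\mathbf k}$ is the ideal of $\mathrm{NSym}^{(\ell)}$ generated by $(\bar\zeta_{\mathcal Q})_{\mathbf n}-(\zeta_{\mathcal Q}^{-1})_{\mathbf n}$ for $\mathbf n\le\mathbf k$ (subscript = restriction to degree $\mathbf n$). $\mathcal O^{\mathbf k}$ is the largest graded subcoalgebra $C$ of $\mathrm{QSym}^{(\ell)}$ with $\bar\zeta_{\mathcal Q}(h)=\zeta_{\mathcal Q}^{-1}(h)$ for all $h\in C$ of degree $\le\mathbf k$. *)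

theory Defs
  imports
    Complex_Main
    "HOL-Library.Function_Algebras"
    "HOL-Library.Extended_Nat"
    "HOL-Library.Poly_Mapping"
    "HOL-Algebra.Ideal"
begin

section \<open>Vector compositions\<close>

text \<open>The number \<open>\<ell> \<ge> 1\<close> is the cardinality of the finite index type \<^typ>\<open>'l\<close>; elements of
  \<open>\<nat>\<^sup>\<ell>\<close> are functions \<open>'l \<Rightarrow> nat\<close> with pointwise order and addition.\<close>

type_synonym 'l vec = "'l \<Rightarrow> nat"

definition weight :: "'l::finite vec \<Rightarrow> nat"
  where "weight n = (\<Sum>i\<in>UNIV. n i)"

definition vle :: "'l vec \<Rightarrow> ('l \<Rightarrow> enat) \<Rightarrow> bool"  (infix \<open>\<le>\<^sub>v\<close> 50)
  where "n \<le>\<^sub>v k \<longleftrightarrow> (\<lambda>i. enat (n i)) \<le> k"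

definition vcomp :: "'l vec list \<Rightarrow> bool"
  where "vcomp I \<longleftrightarrow> 0 \<notin> set I"

definition coarser :: "'l vec list \<Rightarrow> 'l vec list \<Rightarrow> bool"  (infix \<open>\<unlhd>\<^sub>c\<close> 50)
  where "J \<unlhd>\<^sub>c I \<longleftrightarrow> (\<exists>Bs. [] \<notin> set Bs \<and> concat Bs = I \<and> map sum_list Bs = J)"


section \<open>Quasisymmetric functions as power series\<close>

text \<open>A monomial \<open>\<Prod>\<^sub>j x\<^sub>j\<^bsup>a\<^sub>j\<^esup>\<close> is represented by its finitely supported exponent
  \<open>j \<mapsto> a\<^sub>j \<in> \<nat>\<^sup>\<ell>\<close> (so the product of monomials is the sum of exponents), and a power series by
  the function sending a monomial to its coefficient.\<close>

type_synonym 'l monomial = "nat \<Rightarrow>\<^sub>0 'l vec"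
type_synonym 'l series = "'l monomial \<Rightarrow> rat"

definition mono_prod :: "nat list \<Rightarrow> 'l vec list \<Rightarrow> 'l monomial"
  where "mono_prod js I = sum_list (map2 Poly_Mapping.single js I)"

definition mdegree :: "'l monomial \<Rightarrow> 'l vec"
  where "mdegree a = (\<Sum>j\<in>Poly_Mapping.keys a. Poly_Mapping.lookup a j)"

definition M_series :: "'l vec list \<Rightarrow> 'l series"
  where "M_series I =
    (\<lambda>a. of_nat (card {js. length js = length I \<and> sorted_wrt (<) js \<and> mono_prod js I = a}))"

definition fscale :: "rat \<Rightarrow> ('x \<Rightarrow> rat) \<Rightarrow> 'x \<Rightarrow> rat"
  where "fscale c f = (\<lambda>x. c * f x)"

global_interpretation fs: vector_space fscale
  by standard (auto simp: fscale_def algebra_simps fun_eq_iff)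

definition series_component :: "'l vec \<Rightarrow> 'l series \<Rightarrow> 'l series"
  where "series_component n f = (\<lambda>a. if mdegree a = n then f a else 0)"

typedef (overloaded) 'l qsym = "fs.span {M_series I | I :: 'l::finite vec list. vcomp I}"
  by (rule exI[of _ 0]) (rule fs.span_zero)

setup_lifting type_definition_qsym

lemma lookup_mono_prod_notin:
  "j \<notin> set js \<Longrightarrow> Poly_Mapping.lookup (mono_prod js I) j = 0"
proof (induction js arbitrary: I)
  case (Cons a js)
  then show ?case
    by (cases I) (auto simp: mono_prod_def lookup_add lookup_single when_def)
qed (simp add: mono_prod_def)

lemma lookup_mono_prod:
  "length js = length I \<Longrightarrow> distinct js \<Longrightarrow> r < length js \<Longrightarrow>
    Poly_Mapping.lookup (mono_prod js I) (js ! r) = I ! r"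
proof (induction js arbitrary: I r)
  case (Cons a js)
  obtain i I' where I: "I = i # I'" using Cons.prems by (cases I) auto
  have *: "mono_prod (a # js) I = Poly_Mapping.single a i + mono_prod js I'"
    by (simp add: mono_prod_def I)
  show ?case
  proof (cases r)
    case 0
    then show ?thesis using Cons.prems lookup_mono_prod_notin[of a js I']
      by (simp add: *[unfolded I] lookup_add I)
  next
    case (Suc r')
    then have "js ! r' \<noteq> a" using Cons.prems by auto
    then show ?thesis using Cons.prems Cons.IH[of I' r'] Suc
      by (simp add: *[unfolded I] lookup_add I lookup_single)
  qed
qed simp

lemma keys_mono_prod:
  assumes "length js = length I" "distinct js" "vcomp I"
  shows "Poly_Mapping.keys (mono_prod js I) = set js"
proof (intro equalityI subsetI)
  fix j assume "j \<in> set js"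
  then obtain r where r: "r < length js" "j = js ! r" by (auto simp: in_set_conv_nth)
  then have "I ! r \<noteq> 0" using assms by (metis nth_mem vcomp_def)
  then show "j \<in> Poly_Mapping.keys (mono_prod js I)"
    using lookup_mono_prod[OF assms(1,2) r(1)] r by (simp add: in_keys_iff)
next
  fix j assume "j \<in> Poly_Mapping.keys (mono_prod js I)"
  then show "j \<in> set js" using lookup_mono_prod_notin[of j js I] by (auto simp: in_keys_iff)
qed

lemma mdegree_superset:
  "finite A \<Longrightarrow> Poly_Mapping.keys a \<subseteq> A \<Longrightarrow> mdegree a = (\<Sum>j\<in>A. Poly_Mapping.lookup a j)"
  unfolding mdegree_def by (rule sum.mono_neutral_left) (auto simp: in_keys_iff)

lemma mdegree_add: "mdegree (a + b) = mdegree a + mdegree b"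
proof -
  let ?A = "Poly_Mapping.keys a \<union> Poly_Mapping.keys b"
  have "mdegree (a + b) = (\<Sum>j\<in>?A. Poly_Mapping.lookup (a + b) j)"
    by (rule mdegree_superset) (use Poly_Mapping.keys_add[of a b] in auto)
  also have "\<dots> = mdegree a + mdegree b"
    by (simp add: lookup_add sum.distrib mdegree_superset[of ?A])
  finally show ?thesis .
qed

lemma mdegree_single: "mdegree (Poly_Mapping.single j i) = i"
  using mdegree_superset[of "{j}" "Poly_Mapping.single j i"] by simp

lemma mdegree_mono_prod: "length js = length I \<Longrightarrow> mdegree (mono_prod js I) = sum_list I"
proof (induction js I rule: list_induct2)
  case Nil
  then show ?case by (simp add: mono_prod_def mdegree_def)
next
  case (Cons x xs y ys)
  then show ?case by (simp add: mono_prod_def mdegree_add mdegree_single)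
qed

lemma M_series_nonzero_degree:
  assumes "M_series I a \<noteq> 0"
  shows "mdegree a = sum_list I"
proof -
  have "{js. length js = length I \<and> sorted_wrt (<) js \<and> mono_prod js I = a} \<noteq> {}"
    using assms unfolding M_series_def by (metis (no_types, lifting) card.empty of_nat_0)
  then show ?thesis using mdegree_mono_prod by blast
qed

lemma series_component_M:
  "series_component n (M_series I) = (if sum_list I = n then M_series I else 0)"
  using M_series_nonzero_degree[of I] by (intro ext) (auto simp: series_component_def)

lemma series_component_add:
  "series_component n (f + g) = series_component n f + series_component n g"
  by (auto simp: series_component_def fun_eq_iff)

lemma series_component_fscale:
  "series_component n (fscale c f) = fscale c (series_component n f)"
  by (auto simp: series_component_def fun_eq_iff fscale_def)

lemma series_component_qsym:
  assumes "f \<in> fs.span {M_series I | I. vcomp I}"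
  shows "series_component n f \<in> fs.span {M_series I | I. vcomp I}"
  using assms
proof (induction rule: fs.span_induct_alt)
  case base
  have "series_component n 0 = (0 :: 'a series)" by (auto simp: series_component_def fun_eq_iff)
  then show ?case by (simp only: fs.span_zero)
next
  case (step c x y)
  then obtain I where I: "x = M_series I" "vcomp I" by auto
  have "M_series I \<in> fs.span {M_series I | I. vcomp I}"
    by (rule fs.span_base) (use I in auto)
  then have "series_component n x \<in> fs.span {M_series I | I. vcomp I}"
    by (cases "sum_list I = n") (simp_all only: I series_component_M if_True if_False refl fs.span_zero)
  then show ?case using step(2)
    unfolding series_component_add series_component_fscale by (intro fs.span_add fs.span_scale)
qed

instantiation qsym :: (finite) ab_group_add
begin
lift_definition zero_qsym :: "'a qsym" is 0
  by (rule fs.span_zero)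
lift_definition plus_qsym :: "'a qsym \<Rightarrow> 'a qsym \<Rightarrow> 'a qsym" is "(+)"
  by (rule fs.span_add)
lift_definition minus_qsym :: "'a qsym \<Rightarrow> 'a qsym \<Rightarrow> 'a qsym" is "(-)"
  by (rule fs.span_diff)
lift_definition uminus_qsym :: "'a qsym \<Rightarrow> 'a qsym" is "uminus"
  by (rule fs.span_neg)
instance
  by standard (transfer; auto simp: fun_eq_iff)+
end

lift_definition qscale :: "rat \<Rightarrow> 'l::finite qsym \<Rightarrow> 'l qsym" is fscale
  by (rule fs.span_scale)

global_interpretation qs: vector_space qscale
  by standard (transfer; auto simp: fscale_def algebra_simps fun_eq_iff)+

lift_definition component :: "'l::finite vec \<Rightarrow> 'l qsym \<Rightarrow> 'l qsym" is series_component
  by (rule series_component_qsym)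

definition homogeneous :: "'l::finite vec \<Rightarrow> 'l qsym \<Rightarrow> bool"
  where "homogeneous n h \<longleftrightarrow> component n h = h"

text \<open>Meaningful only if \<open>vcomp I\<close>; all uses below are guarded accordingly.\<close>

definition M :: "'l::finite vec list \<Rightarrow> 'l qsym"
  where "M I = Abs_qsym (M_series I)"

definition eta :: "'l::finite vec list \<Rightarrow> 'l qsym"
  where "eta I = (\<Sum>J | J \<unlhd>\<^sub>c I. qscale (2 ^ length J) (M J))"

definition M_coeff :: "'l::finite vec list \<Rightarrow> 'l qsym \<Rightarrow> rat"
  where "M_coeff I h = qs.representation (M ` Collect vcomp) h (M I)"

text \<open>The linear extension of a function prescribed on the basis of the \<open>M\<^sub>I\<close>.\<close>

definition M_extend :: "('l::finite vec list \<Rightarrow> rat) \<Rightarrow> 'l qsym \<Rightarrow> rat"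
  where "M_extend \<phi> h = (\<Sum>I | vcomp I \<and> M_coeff I h \<noteq> 0. M_coeff I h * \<phi> I)"


section \<open>Coalgebra structure\<close>

text \<open>Elements of \<open>QSym \<otimes> QSym\<close> are represented as power series in two sets of variables,
  \<open>f \<otimes> g\<close> being \<open>f(x) g(y)\<close>.\<close>

definition tensor :: "'l::finite qsym \<Rightarrow> 'l qsym \<Rightarrow> 'l monomial \<times> 'l monomial \<Rightarrow> rat"
  where "tensor f g = (\<lambda>(a, b). Rep_qsym f a * Rep_qsym g b)"

definition comult :: "'l::finite qsym \<Rightarrow> 'l monomial \<times> 'l monomial \<Rightarrow> rat"
  where "comult h =
    (\<lambda>ab. M_extend (\<lambda>I. \<Sum>r\<le>length I. tensor (M (take r I)) (M (drop r I)) ab) h)"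

definition counit :: "'l::finite qsym \<Rightarrow> rat"
  where "counit = M_extend (\<lambda>I. if I = [] then 1 else 0)"

definition graded_subcoalgebra :: "'l::finite qsym set \<Rightarrow> bool"
  where "graded_subcoalgebra C \<longleftrightarrow>
    qs.subspace C \<and>
    (\<forall>h\<in>C. \<forall>n. component n h \<in> C) \<and>
    (\<forall>h\<in>C. comult h \<in> fs.span {tensor f g | f g. f \<in> C \<and> g \<in> C})"


section \<open>The graded dual\<close>

definition functional :: "('l::finite qsym \<Rightarrow> rat) \<Rightarrow> bool"
  where "functional f \<longleftrightarrow> Vector_Spaces.linear qscale (*) f"

text \<open>The convolution product \<open>h \<mapsto> (f \<otimes> g)(\<Delta> h)\<close>.\<close>

definition conv :: "('l::finite qsym \<Rightarrow> rat) \<Rightarrow> ('l qsym \<Rightarrow> rat) \<Rightarrow> 'l qsym \<Rightarrow> rat"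
  where "conv f g = M_extend (\<lambda>I. \<Sum>r\<le>length I. f (M (take r I)) * g (M (drop r I)))"

definition conv_inverse :: "('l::finite qsym \<Rightarrow> rat) \<Rightarrow> 'l qsym \<Rightarrow> rat"
  where "conv_inverse f = (THE g. functional g \<and> conv f g = counit \<and> conv g f = counit)"

definition degree_part :: "'l::finite vec \<Rightarrow> ('l qsym \<Rightarrow> rat) \<Rightarrow> 'l qsym \<Rightarrow> rat"
  where "degree_part n f = (\<lambda>h. f (component n h))"

definition NSym :: "('l::finite qsym \<Rightarrow> rat) ring"
  where "NSym = \<lparr>carrier = {f. functional f \<and> finite {n. degree_part n f \<noteq> 0}},
    mult = conv, one = counit, zero = 0, add = (+)\<rparr>"

text \<open>The basis dual to the \<open>\<eta>\<^sub>I\<close>: coordinate functionals with respect to that basis.\<close>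

definition Upsilon :: "'l::finite vec list \<Rightarrow> 'l qsym \<Rightarrow> rat"
  where "Upsilon I = (\<lambda>h. qs.representation (eta ` Collect vcomp) h (eta I))"


section \<open>Odd ideals and odd subcoalgebras\<close>

definition zetaQ :: "'l::finite qsym \<Rightarrow> rat"
  where "zetaQ = M_extend (\<lambda>I. if length I \<le> 1 then 1 else 0)"

definition zetaQ_bar :: "'l::finite qsym \<Rightarrow> rat"
  where "zetaQ_bar h = (\<Sum>n | component n h \<noteq> 0. (-1) ^ weight n * zetaQ (component n h))"

definition odd_ideal :: "('l::finite \<Rightarrow> enat) \<Rightarrow> ('l qsym \<Rightarrow> rat) set"
  where "odd_ideal k = genideal NSym
    {degree_part n zetaQ_bar - degree_part n (conv_inverse zetaQ) | n. n \<le>\<^sub>v k}"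

definition odd_subcoalgebra :: "('l::finite \<Rightarrow> enat) \<Rightarrow> 'l qsym set \<Rightarrow> bool"
  where "odd_subcoalgebra k C \<longleftrightarrow> graded_subcoalgebra C \<and>
    (\<forall>h\<in>C. \<forall>n. n \<le>\<^sub>v k \<and> homogeneous n h \<longrightarrow> zetaQ_bar h = conv_inverse zetaQ h)"

definition odd_coalgebra :: "('l::finite \<Rightarrow> enat) \<Rightarrow> 'l qsym set"
  where "odd_coalgebra k = (GREATEST C. odd_subcoalgebra k C)"


section \<open>Well-definedness\<close>

text \<open>The \<open>M\<^sub>I\<close> and the \<open>\<eta>\<^sub>I\<close> are bases, \<^const>\<open>NSym\<close> is a ring containing the generators of the
  ideals considered, and the descriptions by \<open>THE\<close> and \<open>GREATEST\<close> above denote.\<close>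

lemma M_series_canonical:
  assumes "vcomp I" "vcomp J"
  shows "M_series J (mono_prod [0..<length I] I) = (if I = J then 1 else 0)"
proof -
  let ?A = "{js. length js = length J \<and> sorted_wrt (<) js \<and> mono_prod js J = mono_prod [0..<length I] I}"
  have 1: "js = [0..<length I] \<and> I = J" if js: "js \<in> ?A" for js
  proof -
    have d: "distinct js" using js by (auto simp: strict_sorted_iff)
    have "set js = Poly_Mapping.keys (mono_prod js J)"
      using js d assms keys_mono_prod[of js J] by simp
    also have "\<dots> = set [0..<length I]"
      using js assms keys_mono_prod[of "[0..<length I]" I] by simp
    finally have e: "js = [0..<length I]" using js
      by (intro strict_sorted_equal) (auto simp: strict_sorted_iff)
    have "I = J"
    proof (rule nth_equalityI)
      show "length I = length J" using e js by auto
      fix r assume "r < length I"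
      then show "I ! r = J ! r" using js e
        lookup_mono_prod[of "[0..<length I]" I r] lookup_mono_prod[of "[0..<length I]" J r] by auto
    qed
    then show ?thesis using e by simp
  qed
  show ?thesis
  proof (cases "I = J")
    case True
    then have "?A = {[0..<length I]}" using 1 by (auto simp: strict_sorted_iff)
    then have "card ?A = 1" by simp
    then show ?thesis using True by (simp only: M_series_def) simp
  next
    case False
    then have "?A = {}" using 1 by blast
    then show ?thesis using False unfolding M_series_def by (metis (no_types, lifting) card.empty of_nat_0)
  qed
qed

lemma Rep_M: "vcomp I \<Longrightarrow> Rep_qsym (M I) = M_series I"
  unfolding M_def by (rule Abs_qsym_inverse, rule fs.span_base) auto

lemma Rep_M_canonical:
  "vcomp I \<Longrightarrow> vcomp J \<Longrightarrow> Rep_qsym (M J) (mono_prod [0..<length I] I) = (if I = J then 1 else 0)"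
  by (simp add: Rep_M M_series_canonical)

lemma inj_on_M: "inj_on M (Collect vcomp)"
  by (rule inj_onI) (metis Rep_M_canonical mem_Collect_eq zero_neq_one)

lemma functionalI:
  "(\<And>x y. f (x + y) = f x + f y) \<Longrightarrow> (\<And>c x. f (qscale c x) = c * f x) \<Longrightarrow> functional f"
  unfolding functional_def by (unfold_locales) (auto simp: algebra_simps)

lemma functional_Rep: "functional (\<lambda>h. Rep_qsym h a)"
  by (rule functionalI) (simp_all add: plus_qsym.rep_eq qscale.rep_eq fscale_def)

lemma functional_simps:
  assumes "functional f"
  shows "f (x + y) = f x + f y" "f (qscale c x) = c * f x" "f 0 = 0" "f (sum g A) = (\<Sum>a\<in>A. f (g a))"
    "f (- x) = - f x" "f (x - y) = f x - f y"
proof -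
  interpret Vector_Spaces.linear qscale "(*)" f using assms by (simp add: functional_def)
  show "f (x + y) = f x + f y" "f (qscale c x) = c * f x" "f 0 = 0" "f (sum g A) = (\<Sum>a\<in>A. f (g a))"
    "f (- x) = - f x" "f (x - y) = f x - f y"
    by (fact add scale zero sum neg diff)+
qed

lemma independent_M: "qs.independent (M ` Collect (vcomp :: 'l::finite vec list \<Rightarrow> bool))"
proof
  assume "qs.dependent (M ` Collect (vcomp :: 'l vec list \<Rightarrow> bool))"
  then obtain t :: "'l qsym set" and u where t: "finite t" "t \<subseteq> M ` Collect vcomp" "(\<Sum>v\<in>t. qscale (u v) v) = 0"
    "\<exists>v\<in>t. u v \<noteq> 0" unfolding qs.dependent_explicit by blast
  then obtain I where I: "vcomp I" "M I \<in> t" "u (M I) \<noteq> 0" by blast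
  let ?f = "\<lambda>h. Rep_qsym h (mono_prod [0..<length I] I)"
  note f = functional_simps[OF functional_Rep[of "mono_prod [0..<length I] I"]]
  have "0 = ?f (\<Sum>v\<in>t. qscale (u v) v)" using t f(3) by simp
  also have "\<dots> = (\<Sum>v\<in>t. u v * ?f v)" by (simp add: f)
  also have "\<dots> = (\<Sum>v\<in>t. if v = M I then u v else 0)"
  proof (rule sum.cong)
    fix v assume "v \<in> t"
    then obtain J where "v = M J" "vcomp J" using t(2) by blast
    then show "u v * ?f v = (if v = M I then u v else 0)"
      using I(1) inj_onD[OF inj_on_M, of I J] by (auto simp: Rep_M_canonical)
  qed simp
  also have "\<dots> = u (M I)" using t(1) I(2) by simp
  finally show False using I by simp
qed

lemma span_M: "qs.span (M ` Collect (vcomp :: 'a::finite vec list \<Rightarrow> bool)) = UNIV"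
proof -
  have "h \<in> qs.span (M ` Collect vcomp)" for h :: "'a qsym"
  proof -
    have "x \<in> fs.span {M_series I | I :: 'a vec list. vcomp I} \<Longrightarrow>
       x \<in> Rep_qsym ` qs.span (M ` Collect vcomp)" for x
    proof (induction rule: fs.span_induct_alt)
      case base
      show ?case using qs.span_zero[of "M ` Collect vcomp"] zero_qsym.rep_eq image_iff by metis
    next
      case (step c x y)
      then obtain I g where I: "x = Rep_qsym (M I)" "vcomp I" "y = Rep_qsym g"
        "g \<in> qs.span (M ` Collect vcomp)" using Rep_M by force
      then have "fscale c x + y = Rep_qsym (qscale c (M I) + g)"
        by (simp only: plus_qsym.rep_eq qscale.rep_eq)
      moreover have "qscale c (M I) + g \<in> qs.span (M ` Collect vcomp)"
        using I by (intro qs.span_add qs.span_scale qs.span_base[of "M I"]) auto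
      ultimately show ?case by blast
    qed
    from this[OF Rep_qsym[of h]] show ?thesis by (auto simp: Rep_qsym_inject)
  qed
  then show ?thesis by blast
qed

lemma M_coeff_M:
  "vcomp I \<Longrightarrow> vcomp J \<Longrightarrow> M_coeff I (M J) = (if I = J then 1 else 0)"
  using inj_onD[OF inj_on_M, of I J]
  by (auto simp: M_coeff_def qs.representation_basis[OF independent_M])

lemma functional_M_coeff: "functional (M_coeff I)"
  by (rule functionalI)
    (auto simp: M_coeff_def qs.representation_add[OF independent_M] qs.representation_scale[OF independent_M] span_M)

lemma finite_M_coeff: "finite {I. vcomp I \<and> M_coeff I h \<noteq> 0}"
proof (rule finite_imageD)
  show "finite (M ` {I. vcomp I \<and> M_coeff I h \<noteq> 0})"
    by (rule finite_subset[OF _ qs.finite_representation[of "M ` Collect vcomp" h]])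
      (auto simp: M_coeff_def)
  show "inj_on M {I. vcomp I \<and> M_coeff I h \<noteq> 0}" using inj_on_M by (rule inj_on_subset) auto
qed

lemma M_expansion: "h = (\<Sum>I | vcomp I \<and> M_coeff I h \<noteq> 0. qscale (M_coeff I h) (M I))"
proof -
  let ?R = "qs.representation (M ` Collect vcomp) h"
  have "h = (\<Sum>b | ?R b \<noteq> 0. qscale (?R b) b)"
    using qs.sum_nonzero_representation_eq[OF independent_M, of h] by (simp add: span_M)
  also have "{b. ?R b \<noteq> 0} = M ` {I. vcomp I \<and> M_coeff I h \<noteq> 0}"
    using qs.representation_ne_zero[of "M ` Collect vcomp" h] by (force simp: M_coeff_def)
  also have "(\<Sum>b\<in>\<dots>. qscale (?R b) b) = (\<Sum>I | vcomp I \<and> M_coeff I h \<noteq> 0. qscale (M_coeff I h) (M I))"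
    by (subst sum.reindex) (auto simp: M_coeff_def intro: inj_on_subset[OF inj_on_M])
  finally show ?thesis .
qed

lemma functional_eqI:
  assumes "functional f" "functional g" "\<And>I. vcomp I \<Longrightarrow> f (M I) = g (M I)"
  shows "f = g"
proof
  fix h
  show "f h = g h"
    by (subst (1 2) M_expansion) (simp add: functional_simps[OF assms(1)] functional_simps[OF assms(2)] assms(3))
qed

lemma M_extend_superset:
  assumes "finite A" "{I. vcomp I \<and> M_coeff I h \<noteq> 0} \<subseteq> A" "A \<subseteq> Collect vcomp"
  shows "M_extend \<phi> h = (\<Sum>I\<in>A. M_coeff I h * \<phi> I)"
  unfolding M_extend_def by (rule sum.mono_neutral_left) (use assms in auto)

lemma functional_M_extend: "functional (M_extend \<phi>)"
proof (rule functionalI)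
  note c = functional_simps[OF functional_M_coeff]
  let ?s = "\<lambda>h. {I. vcomp I \<and> M_coeff I h \<noteq> 0}"
  fix x y :: "'a qsym"
  have "M_extend \<phi> h = (\<Sum>I\<in>?s x \<union> ?s y. M_coeff I h * \<phi> I)" if "h \<in> {x, y, x + y}" for h
    using that by (intro M_extend_superset) (auto simp: finite_M_coeff c)
  then show "M_extend \<phi> (x + y) = M_extend \<phi> x + M_extend \<phi> y"
    by (simp add: c sum.distrib distrib_right)
next
  note c = functional_simps[OF functional_M_coeff]
  fix r and x :: "'a qsym"
  have "M_extend \<phi> (qscale r x) = (\<Sum>I | vcomp I \<and> M_coeff I x \<noteq> 0. M_coeff I (qscale r x) * \<phi> I)"
    by (intro M_extend_superset) (auto simp: finite_M_coeff c)
  then show "M_extend \<phi> (qscale r x) = r * M_extend \<phi> x"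
    by (simp add: c M_extend_def sum_distrib_left mult.assoc)
qed

lemma M_extend_M: "vcomp I \<Longrightarrow> M_extend \<phi> (M I) = \<phi> I"
  by (subst M_extend_superset[of "{I}"]) (auto simp: M_coeff_M split: if_splits)

lemma vcomp_take: "vcomp I \<Longrightarrow> vcomp (take r I)"
  unfolding vcomp_def by (meson in_set_takeD)
lemma vcomp_drop: "vcomp I \<Longrightarrow> vcomp (drop r I)"
  unfolding vcomp_def by (meson in_set_dropD)

lemma component_M: "vcomp I \<Longrightarrow> component n (M I) = (if sum_list I = n then M I else 0)"
  by (simp add: Rep_qsym_inject[symmetric] component.rep_eq Rep_M series_component_M zero_qsym.rep_eq)

lemma functional_component: "functional f \<Longrightarrow> functional (degree_part n f)"
proof (rule functionalI)
  assume f: "functional f"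
  fix x y :: "'a qsym" and c
  have "component n (x + y) = component n x + component n y"
    by transfer (rule series_component_add)
  then show "degree_part n f (x + y) = degree_part n f x + degree_part n f y"
    by (simp add: degree_part_def functional_simps[OF f])
  have "component n (qscale c x) = qscale c (component n x)"
    by transfer (rule series_component_fscale)
  then show "degree_part n f (qscale c x) = c * degree_part n f x"
    by (simp add: degree_part_def functional_simps[OF f])
qed

lemma degree_part_nonzero:
  assumes "functional f"
  shows "degree_part n f \<noteq> 0 \<longleftrightarrow> (\<exists>I. vcomp I \<and> sum_list I = n \<and> f (M I) \<noteq> 0)"
proof -
  have 0: "functional 0" by (rule functionalI) auto
  have *: "degree_part n f (M I) = (if sum_list I = n then f (M I) else 0)" if "vcomp I" for I
    using that by (simp add: degree_part_def component_M functional_simps(3)[OF assms])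
  have "degree_part n f \<noteq> 0 \<longleftrightarrow> (\<exists>I. vcomp I \<and> degree_part n f (M I) \<noteq> 0)"
    using functional_eqI[OF functional_component[OF assms] 0, of n] by force
  also have "\<dots> \<longleftrightarrow> (\<exists>I. vcomp I \<and> sum_list I = n \<and> f (M I) \<noteq> 0)"
    using * by (metis (no_types))
  finally show ?thesis .
qed

lemma NSym_iff:
  "f \<in> carrier NSym \<longleftrightarrow> functional f \<and> finite {sum_list I | I. vcomp I \<and> f (M I) \<noteq> 0}"
proof -
  have "{n. degree_part n f \<noteq> 0} = {sum_list I | I. vcomp I \<and> f (M I) \<noteq> 0}" if "functional f"
    by (rule Collect_cong, subst degree_part_nonzero[OF that]) (rule iff_exI, argo)
  then show ?thesis unfolding NSym_def partial_object.simps mem_Collect_eq by (cases "functional f") (simp_all only: simp_thms)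
qed

lemma conv_M: "vcomp I \<Longrightarrow> conv f g (M I) = (\<Sum>r\<le>length I. f (M (take r I)) * g (M (drop r I)))"
  by (simp add: conv_def M_extend_M)

lemma functional_conv: "functional (conv f g)"
  by (simp add: conv_def functional_M_extend)

lemma counit_M: "vcomp I \<Longrightarrow> counit (M I) = (if I = [] then 1 else 0)"
  by (simp add: counit_def M_extend_M)

lemma functional_counit: "functional counit"
  by (simp add: counit_def functional_M_extend)

lemma conv_assoc: "conv (conv f g) h = conv f (conv g h)"
proof (rule functional_eqI[OF functional_conv functional_conv])
  fix I :: "'a vec list" assume I: "vcomp I"
  let ?t = "\<lambda>r s. f (M (take s I)) * g (M (take (r - s) (drop s I))) * h (M (drop r I))"
  have "conv (conv f g) h (M I) = (\<Sum>r\<le>length I. \<Sum>s\<le>r. ?t r s)"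
    by (auto simp: conv_M I vcomp_take sum_distrib_right min_def drop_take intro!: sum.cong)
  also have "\<dots> = (\<Sum>(r, s)\<in>(SIGMA r:{..length I}. {..r}). ?t r s)"
    by (simp add: sum.Sigma)
  also have "\<dots> = (\<Sum>(r, s)\<in>(SIGMA r:{..length I}. {..length I - r}). ?t (r + s) r)"
    by (rule sum.reindex_bij_witness[of _ "\<lambda>(r, s). (r + s, r)" "\<lambda>(r, s). (s, r - s)"]) auto
  also have "\<dots> = (\<Sum>r\<le>length I. \<Sum>s\<le>length I - r. ?t (r + s) r)"
    by (simp add: sum.Sigma)
  also have "\<dots> = conv f (conv g h) (M I)"
    by (auto simp: conv_M I vcomp_drop sum_distrib_left mult.assoc add.commute intro!: sum.cong)
  finally show "conv (conv f g) h (M I) = conv f (conv g h) (M I)" .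
qed

lemma conv_counit:
  assumes "functional f"
  shows "conv f counit = f" "conv counit f = f"
proof -
  show "conv f counit = f"
  proof (rule functional_eqI[OF functional_conv assms])
    fix I :: "'a vec list" assume I: "vcomp I"
    have "conv f counit (M I) = (\<Sum>r\<le>length I. if r = length I then f (M I) else 0)"
      unfolding conv_M[OF I] by (rule sum.cong) (auto simp: I counit_M vcomp_drop)
    then show "conv f counit (M I) = f (M I)" by simp
  qed
  show "conv counit f = f"
  proof (rule functional_eqI[OF functional_conv assms])
    fix I :: "'a vec list" assume I: "vcomp I"
    have "conv counit f (M I) = (\<Sum>r\<le>length I. if r = 0 then f (M I) else 0)"
      unfolding conv_M[OF I] by (rule sum.cong) (auto simp: I counit_M vcomp_take)
    then show "conv counit f (M I) = f (M I)" by simp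
  qed
qed

lemma conv_distrib:
  "conv (f + g) h = conv f h + conv g h" "conv h (f + g) = conv h f + conv h g"
proof -
  have *: "functional (a + b)" if "functional a" "functional b" for a b :: "'a qsym \<Rightarrow> rat"
    by (rule functionalI) (simp_all add: functional_simps[OF that(1)] functional_simps[OF that(2)] algebra_simps)
  show "conv (f + g) h = conv f h + conv g h"
    by (rule functional_eqI) (auto intro!: functional_conv * simp: conv_M sum.distrib distrib_right)
  show "conv h (f + g) = conv h f + conv h g"
    by (rule functional_eqI) (auto intro!: functional_conv * simp: conv_M sum.distrib distrib_left)
qed

lemma ring_NSym: "ring (NSym :: ('l::finite qsym \<Rightarrow> rat) ring)"
proof (rule ringI)
  let ?S = "\<lambda>f :: 'l qsym \<Rightarrow> rat. {sum_list I | I. vcomp I \<and> f (M I) \<noteq> 0}"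
  have add: "f + g \<in> carrier NSym" if "f \<in> carrier NSym" "g \<in> carrier NSym" for f g :: "'l qsym \<Rightarrow> rat"
  proof -
    have "functional (f + g)" using that unfolding NSym_iff
      by (intro functionalI) (simp_all add: functional_simps algebra_simps)
    moreover have "?S (f + g) \<subseteq> ?S f \<union> ?S g" by auto
    ultimately show ?thesis using that unfolding NSym_iff by (meson finite_Un finite_subset)
  qed
  have neg: "- f \<in> carrier NSym" if "f \<in> carrier NSym" for f :: "'l qsym \<Rightarrow> rat"
  proof -
    have "functional (- f)" using that unfolding NSym_iff
      by (intro functionalI) (simp_all add: functional_simps algebra_simps)
    then show ?thesis using that unfolding NSym_iff by simp
  qed
  have zero: "0 \<in> carrier (NSym :: ('l qsym \<Rightarrow> rat) ring)"
    unfolding NSym_iff by (auto intro: functionalI)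
  show "abelian_group (NSym :: ('l qsym \<Rightarrow> rat) ring)"
  proof (rule abelian_groupI)
    fix f :: "'l qsym \<Rightarrow> rat" assume f: "f \<in> carrier NSym"
    show "\<exists>g\<in>carrier NSym. g \<oplus>\<^bsub>NSym\<^esub> f = \<zero>\<^bsub>NSym\<^esub>"
      using neg[OF f] by (intro bexI[of _ "- f"]) (simp_all add: NSym_def)
  qed (use add zero in \<open>simp_all add: NSym_def add_ac\<close>)
  have mult: "conv f g \<in> carrier NSym" if "f \<in> carrier NSym" "g \<in> carrier NSym" for f g :: "'l qsym \<Rightarrow> rat"
  proof -
    have "?S (conv f g) \<subseteq> (\<lambda>(a, b). a + b) ` (?S f \<times> ?S g)"
    proof
      fix n assume "n \<in> ?S (conv f g)"
      then obtain I where I: "n = sum_list I" "vcomp I" "conv f g (M I) \<noteq> 0" by blast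
      from I(3) obtain r where r: "f (M (take r I)) * g (M (drop r I)) \<noteq> 0"
        unfolding conv_M[OF I(2)] by (elim sum.not_neutral_contains_not_neutral)
      have "n = sum_list (take r I) + sum_list (drop r I)" unfolding I(1)
        by (metis append_take_drop_id sum_list.append)
      moreover have "sum_list (take r I) \<in> ?S f" "sum_list (drop r I) \<in> ?S g"
        using r vcomp_take[OF I(2), of r] vcomp_drop[OF I(2), of r] by auto
      ultimately show "n \<in> (\<lambda>(a, b). a + b) ` (?S f \<times> ?S g)" by blast
    qed
    moreover have "finite ((\<lambda>(a, b). a + b) ` (?S f \<times> ?S g))"
      using that unfolding NSym_iff by simp
    ultimately have "finite (?S (conv f g))" by (rule finite_subset)
    then show ?thesis unfolding NSym_iff using functional_conv by blast
  qed
  show "Group.monoid (NSym :: ('l qsym \<Rightarrow> rat) ring)"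
  proof (rule monoidI)
    have "?S counit \<subseteq> {0}" by (auto simp: counit_M split: if_splits)
    then have "finite (?S counit)" by (rule finite_subset) simp
    then have "counit \<in> carrier (NSym :: ('l qsym \<Rightarrow> rat) ring)"
      unfolding NSym_iff using functional_counit by blast
    then show "\<one>\<^bsub>NSym\<^esub> \<in> carrier (NSym :: ('l qsym \<Rightarrow> rat) ring)"
      by (simp add: NSym_def)
  qed (use mult in \<open>simp_all add: NSym_def conv_assoc conv_counit\<close>)
qed (simp_all add: NSym_def conv_distrib)

lemma coarser_refl: "I \<unlhd>\<^sub>c I"
  unfolding coarser_def by (intro exI[of _ "map (\<lambda>i. [i]) I"]) (auto simp: comp_def concat_map_singleton)

lemma coarserE:
  assumes "J \<unlhd>\<^sub>c I"
  obtains Bs where "[] \<notin> set Bs" "concat Bs = I" "map sum_list Bs = J"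
  using assms unfolding coarser_def by blast

lemma coarser_length:
  assumes "J \<unlhd>\<^sub>c I"
  shows "length J \<le> length I" "length J = length I \<Longrightarrow> J = I"
proof -
  obtain Bs where B: "[] \<notin> set Bs" "concat Bs = I" "map sum_list Bs = J"
    using assms by (rule coarserE)
  have "length (map sum_list Bs) \<le> length (concat Bs) \<and>
      (length (map sum_list Bs) = length (concat Bs) \<longrightarrow> map sum_list Bs = concat Bs)"
    using B(1)
  proof (induction Bs)
    case (Cons b Bs)
    then obtain x xs where b: "b = x # xs" by (cases b) auto
    show ?case using Cons b by (cases xs) auto
  qed simp
  then show "length J \<le> length I" "length J = length I \<Longrightarrow> J = I" using B by auto
qed

lemma coarser_sum:
  assumes "J \<unlhd>\<^sub>c I"
  shows "sum_list J = sum_list I"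
proof -
  obtain Bs where B: "concat Bs = I" "map sum_list Bs = J"
    using assms by (rule coarserE)
  have "sum_list (map sum_list Bs) = sum_list (concat Bs)" by (induction Bs) auto
  then show ?thesis using B by simp
qed

lemma sum_list_vec_zero: "sum_list (xs :: 'l vec list) = 0 \<longleftrightarrow> (\<forall>x\<in>set xs. x = 0)"
proof (induction xs)
  case (Cons x xs)
  have "x + y = 0 \<longleftrightarrow> x = 0 \<and> y = 0" for y :: "'l vec" by (auto simp: fun_eq_iff)
  then show ?case using Cons by (simp only: sum_list.Cons list.set ball_simps)
qed simp

lemma coarser_vcomp:
  assumes "J \<unlhd>\<^sub>c I" "vcomp I"
  shows "vcomp J"
proof -
  obtain Bs where B: "[] \<notin> set Bs" "concat Bs = I" "map sum_list Bs = J"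
    using assms(1) by (rule coarserE)
  have "sum_list b \<noteq> 0" if "b \<in> set Bs" for b
  proof -
    have "b \<noteq> []" "0 \<notin> set b" using that B assms(2) by (auto simp: vcomp_def)
    then show ?thesis unfolding sum_list_vec_zero by (metis list.set_intros(1) neq_Nil_conv)
  qed
  then have "0 \<notin> sum_list ` set Bs" by (metis imageE)
  then show ?thesis using B(3) unfolding vcomp_def by (metis set_map)
qed

lemma finite_coarser: "finite {J. J \<unlhd>\<^sub>c I}"
proof -
  have "{J. J \<unlhd>\<^sub>c I} \<subseteq> {J. set J \<subseteq> sum_list ` {b. set b \<subseteq> set I \<and> length b \<le> length I} \<and> length J \<le> length I}"
  proof
    fix J assume "J \<in> {J. J \<unlhd>\<^sub>c I}"
    then have J: "J \<unlhd>\<^sub>c I" by simp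
    then obtain Bs where B: "[] \<notin> set Bs" "concat Bs = I" "map sum_list Bs = J"
      by (rule coarserE)
    have "length b \<le> length (concat Bs)" if "b \<in> set Bs" for b
      using that by (induction Bs) auto
    then show "J \<in> {J. set J \<subseteq> sum_list ` {b. set b \<subseteq> set I \<and> length b \<le> length I} \<and> length J \<le> length I}"
      using coarser_length(1)[OF J] B(2,3) by fastforce
  qed
  then show ?thesis
    by (rule finite_subset) (intro finite_lists_length_le finite_imageI finite_set)
qed

lemma M_coeff_eta:
  assumes "vcomp I" "vcomp J"
  shows "M_coeff I (eta J) = (if I \<unlhd>\<^sub>c J then 2 ^ length I else 0)"
proof -
  have "M_coeff I (eta J) = (\<Sum>K | K \<unlhd>\<^sub>c J. if K = I then 2 ^ length I else 0)"
    unfolding eta_def functional_simps[OF functional_M_coeff]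
    using assms by (intro sum.cong) (auto simp: M_coeff_M coarser_vcomp)
  then show ?thesis by (simp add: finite_coarser sum.delta)
qed

lemma inj_on_eta: "inj_on eta (Collect (vcomp :: 'l::finite vec list \<Rightarrow> bool))"
proof (rule inj_onI)
  fix I J :: "'l vec list" assume a: "I \<in> Collect vcomp" "J \<in> Collect vcomp" "eta I = eta J"
  have v: "vcomp I" "vcomp J" using a by auto
  have "M_coeff I (eta J) \<noteq> 0" "M_coeff J (eta I) \<noteq> 0"
    using M_coeff_eta[OF v(1) v(1)] M_coeff_eta[OF v(2) v(2)] a(3) by (auto simp: coarser_refl)
  then have "I \<unlhd>\<^sub>c J" "J \<unlhd>\<^sub>c I" using M_coeff_eta[OF v] M_coeff_eta[OF v(2) v(1)] by (auto split: if_splits)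
  then show "I = J" using coarser_length by (metis le_antisym)
qed

lemma independent_eta: "qs.independent (eta ` Collect (vcomp :: 'l::finite vec list \<Rightarrow> bool))"
proof
  assume "qs.dependent (eta ` Collect (vcomp :: 'l vec list \<Rightarrow> bool))"
  then obtain t :: "'l qsym set" and u where t: "finite t" "t \<subseteq> eta ` Collect vcomp"
    "(\<Sum>v\<in>t. qscale (u v) v) = 0" "\<exists>v\<in>t. u v \<noteq> 0" unfolding qs.dependent_explicit by blast
  obtain T where T: "T \<subseteq> Collect vcomp" "finite T" "t = eta ` T"
    using t(1,2) by (meson finite_subset_image)
  let ?N = "{I \<in> T. u (eta I) \<noteq> 0}"
  have "finite ?N" "?N \<noteq> {}" using t(4) T by auto
  then have "Max (length ` ?N) \<in> length ` ?N" by (intro Max_in) auto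
  then obtain I where I: "I \<in> ?N" "length I = Max (length ` ?N)" by auto
  have max: "length J \<le> length I" if "J \<in> ?N" for J
    unfolding I(2) using \<open>finite ?N\<close> that by (intro Max_ge) auto
  have vI: "vcomp I" using I T by auto
  have "0 = M_coeff I (\<Sum>v\<in>t. qscale (u v) v)"
    using t(3) functional_simps(3)[OF functional_M_coeff] by simp
  also have "\<dots> = (\<Sum>v\<in>t. u v * M_coeff I v)" by (simp add: functional_simps[OF functional_M_coeff])
  also have "\<dots> = (\<Sum>J\<in>T. u (eta J) * M_coeff I (eta J))"
    unfolding T(3) by (subst sum.reindex) (auto intro: inj_on_subset[OF inj_on_eta T(1)])
  also have "\<dots> = (\<Sum>J\<in>T. if J = I then u (eta I) * 2 ^ length I else 0)"
  proof (rule sum.cong)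
    fix J assume J: "J \<in> T"
    then have vJ: "vcomp J" using T by auto
    show "u (eta J) * M_coeff I (eta J) = (if J = I then u (eta I) * 2 ^ length I else 0)"
    proof (cases "J = I")
      case True
      then show ?thesis using vI by (simp add: M_coeff_eta coarser_refl)
    next
      case False
      then have "u (eta J) = 0 \<or> \<not> I \<unlhd>\<^sub>c J"
        using max[of J] J coarser_length[of I J] by auto
      then show ?thesis using False by (auto simp: M_coeff_eta vI vJ)
    qed
  qed simp
  also have "\<dots> = u (eta I) * 2 ^ length I" using T(2) I(1) by simp
  finally show False using I(1) by simp
qed

lemma M_in_span_eta:
  assumes "vcomp I"
  shows "M I \<in> qs.span (eta ` {J. vcomp J \<and> sum_list J = sum_list I})"
  using assms
proof (induction "length I" arbitrary: I rule: less_induct)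
  case less
  let ?S = "qs.span (eta ` {J. vcomp J \<and> sum_list J = sum_list I})"
  have "eta I = qscale (2 ^ length I) (M I) + (\<Sum>J\<in>{J. J \<unlhd>\<^sub>c I} - {I}. qscale (2 ^ length J) (M J))"
    unfolding eta_def by (rule sum.remove) (simp_all add: finite_coarser coarser_refl)
  then have e: "qscale (2 ^ length I) (M I) = eta I - (\<Sum>J\<in>{J. J \<unlhd>\<^sub>c I} - {I}. qscale (2 ^ length J) (M J))"
    by simp
  have "qscale (2 ^ length J) (M J) \<in> ?S" if "J \<in> {J. J \<unlhd>\<^sub>c I} - {I}" for J
  proof (rule qs.span_scale)
    have J: "J \<unlhd>\<^sub>c I" "J \<noteq> I" using that by auto
    have "length J < length I" using coarser_length[OF J(1)] J(2) by linarith
    from less(1)[OF this coarser_vcomp[OF J(1) less(2)]] coarser_sum[OF J(1)]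
    show "M J \<in> ?S" by simp
  qed
  then have "qscale (2 ^ length I) (M I) \<in> ?S"
    unfolding e by (intro qs.span_diff qs.span_sum qs.span_base[of "eta I"]) (use less(2) in auto)
  from qs.span_scale[OF this, of "inverse (2 ^ length I)"] show ?case by simp
qed

lemma span_eta: "qs.span (eta ` Collect (vcomp :: 'a::finite vec list \<Rightarrow> bool)) = UNIV"
proof -
  have "M I \<in> qs.span (eta ` Collect vcomp)" if "vcomp I" for I :: "'a vec list"
    by (rule set_mp[OF qs.span_mono M_in_span_eta[OF that]]) auto
  then have "qs.span (M ` Collect (vcomp :: 'a vec list \<Rightarrow> bool)) \<subseteq> qs.span (eta ` Collect vcomp)"
    by (intro qs.span_minimal) auto
  then show ?thesis using span_M by blast
qed

lemma Upsilon_eta: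
  "vcomp I \<Longrightarrow> vcomp J \<Longrightarrow> Upsilon I (eta J) = (if I = J then 1 else 0)"
  using inj_onD[OF inj_on_eta, of I J]
  by (auto simp: Upsilon_def qs.representation_basis[OF independent_eta])

lemma functional_Upsilon: "functional (Upsilon I)"
  by (rule functionalI)
    (auto simp: Upsilon_def qs.representation_add[OF independent_eta] qs.representation_scale[OF independent_eta] span_eta)

lemma Upsilon_NSym:
  assumes "vcomp I"
  shows "Upsilon I \<in> carrier NSym"
proof -
  have "Upsilon I (M J) = 0" if J: "vcomp J" "sum_list J \<noteq> sum_list I" for J
  proof -
    have "h \<in> qs.span (eta ` {K. vcomp K \<and> sum_list K = sum_list J}) \<Longrightarrow> Upsilon I h = 0" for h
    proof (induction rule: qs.span_induct_alt)
      case (step c x y)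
      then obtain K where K: "x = eta K" "vcomp K" "sum_list K = sum_list J" by blast
      then have "K \<noteq> I" using J by metis
      then show ?case using K assms step(2)
        by (simp add: functional_simps[OF functional_Upsilon] Upsilon_eta)
    qed (simp add: functional_simps[OF functional_Upsilon])
    then show ?thesis using M_in_span_eta[OF J(1)] by blast
  qed
  then have "{sum_list J | J. vcomp J \<and> Upsilon I (M J) \<noteq> 0} \<subseteq> {sum_list I}" by blast
  then show ?thesis unfolding NSym_iff using functional_Upsilon finite_subset by blast
qed

lemma conv_inverse_zetaQ: "conv_inverse zetaQ = M_extend (\<lambda>I :: 'a::finite vec list. (-1) ^ length I)"
proof -
  let ?g = "M_extend (\<lambda>I :: 'a vec list. (-1) ^ length I)"
  have zg: "conv zetaQ ?g = counit"
  proof (rule functional_eqI[OF functional_conv functional_counit])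
    fix I :: "'a vec list" assume I: "vcomp I"
    have "conv zetaQ ?g (M I) = (\<Sum>r\<le>length I. if r \<in> {0, 1} then (-1) ^ (length I - r) else 0)"
      unfolding conv_M[OF I] zetaQ_def
      by (rule sum.cong) (auto simp: M_extend_M I vcomp_take vcomp_drop)
    also have "\<dots> = (\<Sum>r\<in>{..length I} \<inter> {0, 1}. (-1) ^ (length I - r))"
      by (rule sum.inter_restrict[symmetric]) simp
    also have "\<dots> = counit (M I)"
    proof (cases I)
      case (Cons i I')
      then have "{..length I} \<inter> {0, 1} = {0, 1}" by auto
      then show ?thesis using I Cons by (simp add: counit_M)
    qed (use I in \<open>simp add: counit_M\<close>)
    finally show "conv zetaQ ?g (M I) = counit (M I)" .
  qed
  have gz: "conv ?g zetaQ = counit"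
  proof (rule functional_eqI[OF functional_conv functional_counit])
    fix I :: "'a vec list" assume I: "vcomp I"
    have "conv ?g zetaQ (M I) = (\<Sum>r\<le>length I. if r \<in> {length I - 1, length I} then (-1) ^ r else 0)"
      unfolding conv_M[OF I] zetaQ_def
      by (rule sum.cong) (auto simp: M_extend_M I vcomp_take vcomp_drop)
    also have "\<dots> = (\<Sum>r\<in>{..length I} \<inter> {length I - 1, length I}. (-1) ^ r)"
      by (rule sum.inter_restrict[symmetric]) simp
    also have "\<dots> = counit (M I)"
    proof (cases I)
      case (Cons i I')
      then have "{..length I} \<inter> {length I - 1, length I} = {length I', Suc (length I')}" by auto
      then show ?thesis using I Cons by (simp add: counit_M)
    qed (use I in \<open>simp add: counit_M\<close>)
    finally show "conv ?g zetaQ (M I) = counit (M I)" .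
  qed
  show ?thesis unfolding conv_inverse_def
  proof (rule the_equality)
    fix g :: "'a qsym \<Rightarrow> rat"
    assume g: "functional g \<and> conv zetaQ g = counit \<and> conv g zetaQ = counit"
    have "conv (conv g zetaQ) ?g = g"
      unfolding conv_assoc zg using g by (simp only: conv_counit)
    then have "g = conv (conv g zetaQ) ?g" by (rule sym)
    also have "\<dots> = ?g" using g by (simp add: conv_counit functional_M_extend)
    finally show "g = ?g" .
  qed (use zg gz functional_M_extend in blast)
qed

lemma component_add: "component n (x + y) = component n x + component n y"
  by transfer (rule series_component_add)

lemma component_scale: "component n (qscale c x) = qscale c (component n x)"
  by transfer (rule series_component_fscale)

lemma component_zero: "component n 0 = 0"
  using component_scale[of n 0 0] by simp

lemma component_component: "component n (component m x) = (if m = n then component n x else 0)"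
  by transfer (auto simp: series_component_def fun_eq_iff)

lemma finite_components: "finite {n. component n h \<noteq> 0}"
proof -
  have "h \<in> qs.span (M ` Collect vcomp)" by (simp add: span_M)
  then show ?thesis
  proof (induction rule: qs.span_induct_alt)
    case base
    then show ?case by (simp add: component_zero)
  next
    case (step c x y)
    then obtain I where I: "x = M I" "vcomp I" by auto
    have "{n. component n (qscale c x + y) \<noteq> 0} \<subseteq> insert (sum_list I) {n. component n y \<noteq> 0}"
      by (auto simp: component_add component_scale component_M I)
    then show ?case using step(2) by (meson finite_insert finite_subset)
  qed
qed

lemma functional_zetaQ: "functional zetaQ"
  by (simp add: zetaQ_def functional_M_extend)

lemma zetaQ_bar_superset:
  assumes "finite A" "{n. component n h \<noteq> 0} \<subseteq> A"
  shows "zetaQ_bar h = (\<Sum>n\<in>A. (-1) ^ weight n * zetaQ (component n h))"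
  unfolding zetaQ_bar_def
  by (rule sum.mono_neutral_left) (use assms in \<open>auto simp: functional_simps(3)[OF functional_zetaQ]\<close>)

lemma functional_zetaQ_bar: "functional zetaQ_bar"
proof (rule functionalI)
  note z = functional_simps[OF functional_zetaQ]
  fix x y :: "'a qsym" and c
  let ?A = "{n. component n x \<noteq> 0} \<union> {n. component n y \<noteq> 0}"
  have A: "zetaQ_bar h = (\<Sum>n\<in>?A. (-1) ^ weight n * zetaQ (component n h))"
    if "{n. component n h \<noteq> 0} \<subseteq> ?A" for h
    using that by (intro zetaQ_bar_superset) (auto simp: finite_components)
  show "zetaQ_bar (x + y) = zetaQ_bar x + zetaQ_bar y"
    by (subst (1 2 3) A) (auto simp: component_add z distrib_left sum.distrib)
  show "zetaQ_bar (qscale c x) = c * zetaQ_bar x"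
    by (subst (1 2) A) (auto simp: component_scale z sum_distrib_left mult_ac intro!: sum.cong)
qed

lemma odd_ideal_generator_NSym:
  "degree_part n zetaQ_bar - degree_part n (conv_inverse zetaQ) \<in> carrier NSym"
proof -
  have fi: "functional (conv_inverse zetaQ :: 'a qsym \<Rightarrow> rat)"
    by (simp add: conv_inverse_zetaQ functional_M_extend)
  have dp: "degree_part n f (M J) = 0" if "functional f" "vcomp J" "sum_list J \<noteq> n"
    for f :: "'a qsym \<Rightarrow> rat" and J
    using that by (simp add: degree_part_def component_M functional_simps(3))
  let ?d = "degree_part n zetaQ_bar - degree_part n (conv_inverse zetaQ)"
  have "functional ?d"
    by (rule functionalI) (simp_all add: algebra_simps
        functional_simps[OF functional_component[OF functional_zetaQ_bar]]
        functional_simps[OF functional_component[OF fi]])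
  moreover have "{sum_list J | J. vcomp J \<and> ?d (M J) \<noteq> 0} \<subseteq> {n}"
  proof
    fix m assume "m \<in> {sum_list J | J. vcomp J \<and> ?d (M J) \<noteq> 0}"
    then obtain J where J: "m = sum_list J" "vcomp J" "?d (M J) \<noteq> 0" by blast
    then have "sum_list J = n"
      using dp[OF functional_zetaQ_bar J(2)] dp[OF fi J(2)] by (metis diff_self minus_apply)
    then show "m \<in> {n}" using J(1) by simp
  qed
  ultimately show ?thesis unfolding NSym_iff using finite_subset by blast
qed

lemma comult_add: "comult (x + y) = comult x + comult y"
  by (simp add: comult_def fun_eq_iff functional_simps[OF functional_M_extend])

lemma comult_scale: "comult (qscale c x) = fscale c (comult x)"
  by (simp add: comult_def fun_eq_iff fscale_def functional_simps[OF functional_M_extend])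

lemma comult_zero: "comult 0 = 0"
  by (simp add: comult_def fun_eq_iff functional_simps[OF functional_M_extend])

text \<open>A largest element exists, namely the sum of all subcoalgebras with the required property.\<close>

lemma odd_coalgebra_greatest:
  "odd_subcoalgebra k (odd_coalgebra k)"
  "odd_subcoalgebra k C \<Longrightarrow> C \<subseteq> odd_coalgebra k"
proof -
  define D where "D = qs.span (\<Union>{C. odd_subcoalgebra k C})"
  have sub: "C \<subseteq> D" if "odd_subcoalgebra k C" for C
    unfolding D_def by (rule subset_trans[OF _ qs.span_superset]) (use that in auto)
  have D: "P h" if h: "h \<in> D" and "P 0" "\<And>C c x y. odd_subcoalgebra k C \<Longrightarrow> x \<in> C \<Longrightarrow> P y \<Longrightarrow> P (qscale c x + y)"
    for P h
    using h unfolding D_def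
  proof (induction rule: qs.span_induct_alt)
    case base
    show ?case by (rule that(2))
  next
    case (step c x y)
    then obtain C where "odd_subcoalgebra k C" "x \<in> C" by auto
    from that(3)[OF this step(2)] show ?case .
  qed
  have subD: "qs.subspace D" by (simp add: D_def)
  have comp: "component n h \<in> D" if "h \<in> D" for h n
  proof (rule D[OF that])
    show "component n 0 \<in> D" using subD by (simp add: component_zero qs.subspace_0)
    fix C c x y assume "odd_subcoalgebra k C" "x \<in> C" "component n y \<in> D"
    then have "component n x \<in> D"
      using sub[of C] by (auto simp: odd_subcoalgebra_def graded_subcoalgebra_def)
    then show "component n (qscale c x + y) \<in> D"
      using subD \<open>component n y \<in> D\<close>
      by (simp add: component_add component_scale qs.subspace_add qs.subspace_scale)
  qed
  have com: "comult h \<in> fs.span {tensor f g | f g. f \<in> D \<and> g \<in> D}" (is "_ \<in> ?T") if "h \<in> D" for h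
  proof (rule D[OF that])
    show "comult 0 \<in> ?T" unfolding comult_zero by (rule fs.span_zero)
    fix C c x y assume a: "odd_subcoalgebra k C" "x \<in> C" "comult y \<in> ?T"
    have "comult x \<in> fs.span {tensor f g | f g. f \<in> C \<and> g \<in> C}"
      using a by (auto simp: odd_subcoalgebra_def graded_subcoalgebra_def)
    moreover have "{tensor f g | f g. f \<in> C \<and> g \<in> C} \<subseteq> {tensor f g | f g. f \<in> D \<and> g \<in> D}"
      using sub[OF a(1)] by blast
    ultimately have "comult x \<in> ?T" by (rule subsetD[OF fs.span_mono, rotated])
    then show "comult (qscale c x + y) \<in> ?T"
      unfolding comult_add comult_scale by (intro fs.span_add fs.span_scale a(3))
  qed
  have fi: "functional (conv_inverse zetaQ :: 'a qsym \<Rightarrow> rat)"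
    by (simp add: conv_inverse_zetaQ functional_M_extend)
  note z = functional_simps[OF functional_zetaQ_bar] functional_simps[OF fi]
  have eq: "zetaQ_bar (component n h) = conv_inverse zetaQ (component n h)" if n: "n \<le>\<^sub>v k" and "h \<in> D" for n h
  proof (rule D[OF that(2)])
    show "zetaQ_bar (component n 0) = conv_inverse zetaQ (component n 0)"
      by (simp add: component_zero z)
    fix C c x y assume a: "odd_subcoalgebra k C" "x \<in> C"
      "zetaQ_bar (component n y) = conv_inverse zetaQ (component n y)"
    have "component n x \<in> C" "homogeneous n (component n x)"
      using a by (auto simp: odd_subcoalgebra_def graded_subcoalgebra_def homogeneous_def component_component)
    then have "zetaQ_bar (component n x) = conv_inverse zetaQ (component n x)"
      using a(1) n unfolding odd_subcoalgebra_def by blast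
    then show "zetaQ_bar (component n (qscale c x + y)) = conv_inverse zetaQ (component n (qscale c x + y))"
      using a(3) by (simp add: component_add component_scale z)
  qed
  have "odd_subcoalgebra k D"
    unfolding odd_subcoalgebra_def graded_subcoalgebra_def
  proof (intro conjI ballI allI impI)
    fix h n assume h: "h \<in> D" and n: "n \<le>\<^sub>v k \<and> homogeneous n h"
    then have "component n h = h" by (simp add: homogeneous_def)
    then show "zetaQ_bar h = conv_inverse zetaQ h" using eq[of n h] h n by simp
  qed (fact subD comp com)+
  moreover from this have "odd_coalgebra k = D"
    unfolding odd_coalgebra_def
    by (rule Greatest_equality) (rule sub)
  ultimately show "odd_subcoalgebra k (odd_coalgebra k)"
    "odd_subcoalgebra k C \<Longrightarrow> C \<subseteq> odd_coalgebra k" using sub by simp_all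
qed

end

theory Submission
  imports Defs
begin

text \<open>The coproduct deconcatenates \<open>\<eta>\<^sub>I\<close>, so \<open>\<Upsilon>\<^sup>I\<close> is the product of the \<open>\<Upsilon>\<^sub>i\<close> over the
  parts of \<open>I\<close>. On nonempty \<open>I\<close> the characters are \<open>\<zeta>(\<eta>\<^sub>I) = 2\<close> and \<open>\<zeta>\<^sup>-\<^sup>1(\<eta>\<^sub>I) = 2 (-1)\<^bsup>len I\<^esup>\<close>, so
  the generator of degree \<open>n \<noteq> 0\<close> of the odd ideal is the sum of \<open>2 ((-1)\<^bsup>|n|\<^esup> - (-1)\<^bsup>len I\<^esup>) \<Upsilon>\<^sup>I\<close> over the
  compositions \<open>I\<close> of \<open>n\<close>. By parity, each \<open>I\<close> with a nonzero coefficient has a part of even weight;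
  for \<open>|n|\<close> even the term of length one is \<open>4 \<Upsilon>\<^sub>n\<close>. Induction on the weight shows that both
  families generate the same ideal.

  For the coalgebra, the annihilator of a subcoalgebra is an ideal of NSym. If it contains the
  generators of the odd ideal, it contains \<open>\<Upsilon>\<^sup>I\<close> for each \<open>I\<close> with a part \<open>\<le> k\<close> of even
  weight, and the elements killed by all these \<open>\<Upsilon>\<^sup>I\<close> are spanned by the remaining \<open>\<eta>\<^sub>I\<close>.\<close>


section \<open>Deconcatenation of \<open>\<eta>\<close>\<close>

text \<open>A grouping of I whose sums are K @ L splits after the blocks that sum to K; the cut r is
  the total length of those blocks.\<close>

lemma coarser_append_iff:
  "K @ L \<unlhd>\<^sub>c I \<longleftrightarrow> (\<exists>r\<le>length I. K \<unlhd>\<^sub>c take r I \<and> L \<unlhd>\<^sub>c drop r I)"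
proof
  assume "K @ L \<unlhd>\<^sub>c I"
  then obtain Bs where B: "[] \<notin> set Bs" "concat Bs = I" "map sum_list Bs = K @ L"
    by (rule coarserE)
  from B(3) obtain Bs1 Bs2 where Bs: "Bs = Bs1 @ Bs2" "K = map sum_list Bs1" "L = map sum_list Bs2"
    by (auto simp: map_eq_append_conv)
  have "K \<unlhd>\<^sub>c take (length (concat Bs1)) I" "L \<unlhd>\<^sub>c drop (length (concat Bs1)) I"
    unfolding coarser_def using B(1,2) Bs by (auto intro: exI[of _ Bs1] exI[of _ Bs2])
  moreover have "length (concat Bs1) \<le> length I" using B(2) Bs(1) by auto
  ultimately show "\<exists>r\<le>length I. K \<unlhd>\<^sub>c take r I \<and> L \<unlhd>\<^sub>c drop r I" by blast
next
  assume "\<exists>r\<le>length I. K \<unlhd>\<^sub>c take r I \<and> L \<unlhd>\<^sub>c drop r I"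
  then obtain r where "K \<unlhd>\<^sub>c take r I" "L \<unlhd>\<^sub>c drop r I" by blast
  then obtain A B where "[] \<notin> set A" "concat A = take r I" "map sum_list A = K"
    "[] \<notin> set B" "concat B = drop r I" "map sum_list B = L" by (metis coarserE)
  then show "K @ L \<unlhd>\<^sub>c I"
    unfolding coarser_def by (intro exI[of _ "A @ B"]) auto
qed

lemma sum_list_take_less:
  assumes "vcomp I" "r < s" "s \<le> length I"
  shows "sum_list (take r I) \<noteq> sum_list (take s I)"
proof
  assume eq: "sum_list (take r I) = sum_list (take s I)"
  let ?D = "drop r (take s I)"
  have "take s I = take r I @ ?D"
    using append_take_drop_id[of r "take s I"] assms(2) by (simp add: min_def)
  then have "sum_list (take s I) = sum_list (take r I) + sum_list ?D" by (metis sum_list.append)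
  then have "sum_list ?D = 0" using eq by simp
  moreover have "?D \<noteq> []" using assms by simp
  ultimately have "0 \<in> set ?D" unfolding sum_list_vec_zero by (metis list.set_sel(1))
  then show False using assms(1) unfolding vcomp_def by (meson in_set_dropD in_set_takeD)
qed

lemma sum_list_take_inject:
  assumes "vcomp I" "r \<le> length I" "s \<le> length I" "sum_list (take r I) = sum_list (take s I)"
  shows "r = s"
  using sum_list_take_less[OF assms(1), of r s] sum_list_take_less[OF assms(1), of s r] assms
  by (metis linorder_neqE_nat)

text \<open>Cutting a coarsening of I amounts to cutting I and coarsening the two pieces
  independently. This is the combinatorial core of the coproduct formula for
  \<open>eta\<close>.\<close>

lemma sum_coarser_cuts:
  fixes \<phi> :: "'l vec list \<Rightarrow> 'l vec list \<Rightarrow> rat"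
  assumes "vcomp I"
  shows "(\<Sum>J | J \<unlhd>\<^sub>c I. \<Sum>r\<le>length J. \<phi> (take r J) (drop r J)) =
    (\<Sum>r\<le>length I. \<Sum>K | K \<unlhd>\<^sub>c take r I. \<Sum>L | L \<unlhd>\<^sub>c drop r I. \<phi> K L)"
proof -
  have "(\<Sum>J | J \<unlhd>\<^sub>c I. \<Sum>r\<le>length J. \<phi> (take r J) (drop r J)) =
      (\<Sum>(J, r)\<in>(SIGMA J:{J. J \<unlhd>\<^sub>c I}. {..length J}). \<phi> (take r J) (drop r J))"
    by (simp add: sum.Sigma finite_coarser)
  also have "\<dots> = (\<Sum>(K, L)\<in>{(K, L). K @ L \<unlhd>\<^sub>c I}. \<phi> K L)"
    by (rule sum.reindex_bij_witness[of _ "\<lambda>(K, L). (K @ L, length K)" "\<lambda>(J, r). (take r J, drop r J)"])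
      auto
  also have "{(K, L). K @ L \<unlhd>\<^sub>c I} =
      (\<Union>r\<in>{..length I}. {K. K \<unlhd>\<^sub>c take r I} \<times> {L. L \<unlhd>\<^sub>c drop r I})"
    by (auto simp: coarser_append_iff)
  also have "(\<Sum>(K, L)\<in>\<dots>. \<phi> K L) =
      (\<Sum>r\<le>length I. \<Sum>(K, L)\<in>{K. K \<unlhd>\<^sub>c take r I} \<times> {L. L \<unlhd>\<^sub>c drop r I}. \<phi> K L)"
  proof (rule sum.UNION_disjoint)
    show "\<forall>r\<in>{..length I}. \<forall>s\<in>{..length I}. r \<noteq> s \<longrightarrow>
        ({K. K \<unlhd>\<^sub>c take r I} \<times> {L. L \<unlhd>\<^sub>c drop r I}) \<inter> ({K. K \<unlhd>\<^sub>c take s I} \<times> {L. L \<unlhd>\<^sub>c drop s I}) = {}"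
    proof (intro ballI impI equals0I)
      fix r s p assume rs: "r \<in> {..length I}" "s \<in> {..length I}" "r \<noteq> s" and
        p: "p \<in> ({K. K \<unlhd>\<^sub>c take r I} \<times> {L. L \<unlhd>\<^sub>c drop r I}) \<inter> ({K. K \<unlhd>\<^sub>c take s I} \<times> {L. L \<unlhd>\<^sub>c drop s I})"
      from p have "fst p \<unlhd>\<^sub>c take r I" "fst p \<unlhd>\<^sub>c take s I" by auto
      \<comment> \<open>The cut is determined by K: its total is a partial sum of I, and partial
        sums are distinct because no column is zero.\<close>
      then have "sum_list (take r I) = sum_list (take s I)" by (metis coarser_sum)
      then show False using sum_list_take_inject[OF assms] rs by auto
    qed
  qed (auto simp: finite_coarser)
  also have "\<dots> = (\<Sum>r\<le>length I. \<Sum>K | K \<unlhd>\<^sub>c take r I. \<Sum>L | L \<unlhd>\<^sub>c drop r I. \<phi> K L)"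
    by (simp add: sum.cartesian_product)
  finally show ?thesis .
qed

section \<open>Functionals, coproduct and grading on the \<open>eta\<close> basis\<close>

lemma functional_eta:
  "functional f \<Longrightarrow> f (eta I) = (\<Sum>J | J \<unlhd>\<^sub>c I. 2 ^ length J * f (M J))"
  by (simp add: eta_def functional_simps)

lemma M_extend_eta:
  "vcomp I \<Longrightarrow> M_extend \<phi> (eta I) = (\<Sum>J | J \<unlhd>\<^sub>c I. 2 ^ length J * \<phi> J)"
  unfolding functional_eta[OF functional_M_extend]
  by (rule sum.cong) (auto simp: M_extend_M coarser_vcomp)

text \<open>The weight 2^len J is multiplicative across a cut, so \<open>eta\<close> deconcatenates
  just as \<open>M\<close> does. With general f and g the formula serves both convolution and the
  coproduct.\<close>

lemma M_extend_cuts_eta: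
  assumes I: "vcomp I" and f: "functional f" and g: "functional g"
  shows "M_extend (\<lambda>I. \<Sum>r\<le>length I. f (M (take r I)) * g (M (drop r I))) (eta I) =
    (\<Sum>r\<le>length I. f (eta (take r I)) * g (eta (drop r I)))"
proof -
  have "M_extend (\<lambda>I. \<Sum>r\<le>length I. f (M (take r I)) * g (M (drop r I))) (eta I) =
      (\<Sum>J | J \<unlhd>\<^sub>c I. \<Sum>r\<le>length J. (2 ^ length (take r J) * f (M (take r J))) *
        (2 ^ length (drop r J) * g (M (drop r J))))"
    unfolding M_extend_eta[OF I] sum_distrib_left
  proof (intro sum.cong refl)
    fix J :: "'a vec list" and r assume "r \<in> {..length J}"
    then have "length J = length (take r J) + length (drop r J)" by simp
    then have "(2 :: rat) ^ length J = 2 ^ length (take r J) * 2 ^ length (drop r J)"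
      by (simp only: power_add)
    then show "2 ^ length J * (f (M (take r J)) * g (M (drop r J))) =
        2 ^ length (take r J) * f (M (take r J)) * (2 ^ length (drop r J) * g (M (drop r J)))"
      by (simp only: mult_ac)
  qed
  also have "\<dots> = (\<Sum>r\<le>length I. \<Sum>K | K \<unlhd>\<^sub>c take r I. \<Sum>L | L \<unlhd>\<^sub>c drop r I.
      (2 ^ length K * f (M K)) * (2 ^ length L * g (M L)))"
    by (rule sum_coarser_cuts[OF I])
  also have "\<dots> = (\<Sum>r\<le>length I. f (eta (take r I)) * g (eta (drop r I)))"
    by (simp add: functional_eta[OF f] functional_eta[OF g] sum_product)
  finally show ?thesis .
qed

lemma conv_eta:
  "vcomp I \<Longrightarrow> functional f \<Longrightarrow> functional g \<Longrightarrow>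
    conv f g (eta I) = (\<Sum>r\<le>length I. f (eta (take r I)) * g (eta (drop r I)))"
  unfolding conv_def by (rule M_extend_cuts_eta)

lemma sum_function_apply: "sum F A x = (\<Sum>a\<in>A. F a x)" for F :: "'a \<Rightarrow> 'b \<Rightarrow> rat"
  by (induction A rule: infinite_finite_induct) simp_all

lemma comult_eta:
  assumes "vcomp I"
  shows "comult (eta I) = (\<Sum>r\<le>length I. tensor (eta (take r I)) (eta (drop r I)))"
proof
  fix ab :: "'a monomial \<times> 'a monomial"
  show "comult (eta I) ab = (\<Sum>r\<le>length I. tensor (eta (take r I)) (eta (drop r I))) ab"
    \<comment> \<open>Here f and g extract the coefficients of the two monomials in
      \<open>ab\<close>.\<close>
    using M_extend_cuts_eta[OF assms functional_Rep[of "fst ab"] functional_Rep[of "snd ab"]]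
    by (simp add: comult_def tensor_def case_prod_beta sum_function_apply)
qed

lemma component_sum:
  "component n (sum h A) = (\<Sum>a\<in>A. component n (h a))"
  by (induction A rule: infinite_finite_induct) (simp_all add: component_zero component_add)

lemma component_eta:
  assumes "vcomp I"
  shows "component n (eta I) = (if sum_list I = n then eta I else 0)"
proof -
  have "component n (eta I) = (\<Sum>J | J \<unlhd>\<^sub>c I. if sum_list I = n then qscale (2 ^ length J) (M J) else 0)"
    unfolding eta_def component_sum component_scale
    by (intro sum.cong) (auto simp: component_M coarser_vcomp[OF _ assms] coarser_sum)
  then show ?thesis by (simp add: eta_def)
qed

lemma functional_eqI_eta:
  assumes "functional f" "functional g" "\<And>I. vcomp I \<Longrightarrow> f (eta I) = g (eta I)"
  shows "f = g"
proof
  fix h :: "'a qsym"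
  have "h \<in> qs.span (eta ` Collect vcomp)" by (simp add: span_eta)
  then show "f h = g h"
    by (induction rule: qs.span_induct_alt)
      (auto simp: functional_simps[OF assms(1)] functional_simps[OF assms(2)] assms(3))
qed

text \<open>Dual to deconcatenation of \<open>eta\<close>: the only cut of K that can contribute is
  the one at length I, and it does so exactly when K = I @ J.\<close>

lemma Upsilon_append:
  assumes "vcomp I" "vcomp J"
  shows "Upsilon (I @ J) = conv (Upsilon I) (Upsilon J)"
proof (rule functional_eqI_eta[OF functional_Upsilon functional_conv])
  fix K :: "'a vec list" assume K: "vcomp K"
  have IJ: "vcomp (I @ J)" using assms by (auto simp: vcomp_def)
  have cut: "(if I = take r K then 1 else 0) * (if J = drop r K then 1 else 0) =
      (if r = length I then if K = I @ J then 1 else 0 else (0 :: rat))" if "r \<le> length K" for r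
  proof -
    have indicators: "(if P then 1 else 0) * (if Q then 1 else 0) = (if R then if S then 1 else 0 else (0 :: rat))"
      if "P \<and> Q \<longleftrightarrow> R \<and> S" for P Q R S
      using that by auto
    show ?thesis
      by (rule indicators) (use that in \<open>auto simp: append_eq_conv_conj\<close>)
  qed
  have "conv (Upsilon I) (Upsilon J) (eta K) =
      (\<Sum>r\<le>length K. if r = length I then (if K = I @ J then 1 else 0) else 0)"
    unfolding conv_eta[OF K functional_Upsilon functional_Upsilon]
  proof (rule sum.cong)
    fix r assume "r \<in> {..length K}"
    then have "r \<le> length K" by simp
    then show "Upsilon I (eta (take r K)) * Upsilon J (eta (drop r K)) =
        (if r = length I then (if K = I @ J then 1 else 0) else 0)"
      by (simp add: Upsilon_eta assms vcomp_take[OF K] vcomp_drop[OF K] cut)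
  qed simp
  also have "\<dots> = (if K = I @ J then 1 else 0)" by (simp add: sum.delta)
  finally show "Upsilon (I @ J) (eta K) = conv (Upsilon I) (Upsilon J) (eta K)"
    using Upsilon_eta[OF IJ K] by (simp add: eq_commute)
qed


section \<open>The characters on the \<open>\<eta>\<close> basis\<close>

lemma coarser_Nil_iff: "J \<unlhd>\<^sub>c [] \<longleftrightarrow> J = []"
  using coarser_length(1)[of J "[]"] coarser_refl[of "[]"] by auto

lemma eta_Nil: "eta [] = M []"
  by (simp add: eta_def coarser_Nil_iff)

text \<open>A nonempty I has exactly one coarsening of length at most one, its total, which occurs
  in \<open>eta I\<close> with coefficient 2.\<close>

lemma zetaQ_eta:
  assumes "vcomp I"
  shows "zetaQ (eta I) = (if I = [] then 1 else 2)"
proof (cases "I = []")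
  case True
  then show ?thesis using assms by (simp add: eta_Nil zetaQ_def M_extend_M)
next
  case False
  have single: "J \<unlhd>\<^sub>c I \<and> length J \<le> 1 \<longleftrightarrow> J = [sum_list I]" for J
  proof
    assume J: "J \<unlhd>\<^sub>c I \<and> length J \<le> 1"
    then have "J \<noteq> []" using False by (auto elim!: coarserE)
    then obtain j where "J = [j]" using J by (cases J) auto
    then show "J = [sum_list I]" using J coarser_sum[of J I] by simp
  next
    assume "J = [sum_list I]"
    then show "J \<unlhd>\<^sub>c I \<and> length J \<le> 1"
      unfolding coarser_def using False by (auto intro!: exI[of _ "[I]"])
  qed
  have "zetaQ (eta I) = (\<Sum>J | J \<unlhd>\<^sub>c I. if J = [sum_list I] then 2 else 0)"
    unfolding zetaQ_def M_extend_eta[OF assms]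
    by (intro sum.cong refl) (use single in auto)
  also have "\<dots> = 2" using single[of "[sum_list I]"] by (simp add: finite_coarser)
  finally show ?thesis using False by simp
qed

lemma conv_inverse_zetaQ_conv: "conv (conv_inverse zetaQ) zetaQ = counit"
proof (rule functional_eqI[OF functional_conv functional_counit])
  fix I :: "'a vec list" assume I: "vcomp I"
  have "conv (conv_inverse zetaQ) zetaQ (M I) =
      (\<Sum>r\<le>length I. if length I - r \<le> 1 then (-1) ^ r else 0)"
    unfolding conv_M[OF I] conv_inverse_zetaQ unfolding zetaQ_def
    by (intro sum.cong) (auto simp: M_extend_M I vcomp_take vcomp_drop)
  also have "\<dots> = (if I = [] then 1 else 0)"
  proof (cases I)
    case (Cons i I')
    \<comment> \<open>Only the last two cuts leave at most one column on the right, and their signs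
      cancel.\<close>
    have "(\<Sum>r\<le>length I. if length I - r \<le> 1 then (-1) ^ r else 0) =
        (\<Sum>r\<in>{length I', Suc (length I')}. (-1) ^ r :: rat)"
      using Cons by (intro sum.mono_neutral_cong_right) auto
    then show ?thesis using Cons by simp
  qed simp
  finally show "conv (conv_inverse zetaQ) zetaQ (M I) = counit (M I)"
    using I by (simp add: counit_M)
qed

lemma functional_conv_inverse_zetaQ: "functional (conv_inverse zetaQ)"
  by (simp add: conv_inverse_zetaQ functional_M_extend)

text \<open>Let x_r be the value on the first r parts. Evaluating the inverse identity on the prefix
  of length n + 1 gives x_(n+1) + 2 (x_0 + ... + x_n) = 0, so the partial sums alternate between 1
  and -1.\<close>

lemma conv_inverse_zetaQ_eta:
  assumes "vcomp I"
  shows "conv_inverse zetaQ (eta I) = (if I = [] then 1 else 2 * (-1) ^ length I)"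
proof -
  let ?x = "\<lambda>r. conv_inverse zetaQ (eta (take r I))"
  have x0: "?x 0 = 1"
    by (simp add: eta_Nil conv_inverse_zetaQ M_extend_M vcomp_def)
  have rec: "?x (Suc n) + 2 * (\<Sum>r\<le>n. ?x r) = 0" if n: "Suc n \<le> length I" for n
  proof -
    let ?I = "take (Suc n) I"
    have v: "vcomp ?I" using assms by (rule vcomp_take)
    have ne: "?I \<noteq> []" using n by auto
    have "0 = conv (conv_inverse zetaQ) zetaQ (eta ?I)"
    proof -
      have "counit (eta ?I) = 0"
        unfolding counit_def M_extend_eta[OF v]
        using ne by (intro sum.neutral) (auto elim!: coarserE)
      then show ?thesis by (simp add: conv_inverse_zetaQ_conv)
    qed
    also have "\<dots> = (\<Sum>r\<le>Suc n. conv_inverse zetaQ (eta (take r ?I)) * zetaQ (eta (drop r ?I)))"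
      using n by (simp only: conv_eta[OF v functional_conv_inverse_zetaQ functional_zetaQ]) (simp add: min_def)
    also have "\<dots> = (\<Sum>r\<le>Suc n. ?x r * (if r = Suc n then 1 else 2))"
      using n by (intro sum.cong refl) (auto simp: zetaQ_eta vcomp_drop v min_def)
    also have "\<dots> = ?x (Suc n) + 2 * (\<Sum>r\<le>n. ?x r)"
      by (simp add: sum_distrib_left mult.commute)
    finally show ?thesis by simp
  qed
  have sum: "(\<Sum>r\<le>n. ?x r) = (-1) ^ n" if "n \<le> length I" for n
    using that
  proof (induction n)
    case (Suc n)
    then show ?case using rec[of n] by simp
  qed (simp add: x0[simplified])
  show ?thesis
  proof (cases "length I")
    case 0
    then show ?thesis using x0 by simp
  next
    case (Suc n)
    then show ?thesis using rec[of n] sum[of n] by auto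
  qed
qed

section \<open>Generators of the odd ideal and parity of parts\<close>

definition odd_generator :: "'l::finite vec \<Rightarrow> 'l qsym \<Rightarrow> rat"
  where "odd_generator n = degree_part n zetaQ_bar - degree_part n (conv_inverse zetaQ)"

lemma zetaQ_bar_component: "zetaQ_bar (component n h) = (-1) ^ weight n * zetaQ (component n h)"
  by (subst zetaQ_bar_superset[of "{n}"]) (auto simp: component_component)

text \<open>\<open>eta I\<close> is homogeneous, and for nonempty I both characters equal 2 up to
  sign. For I = [] both are 1 and cancel, so the generator of degree 0 vanishes.\<close>

lemma odd_generator_eta:
  assumes "vcomp I"
  shows "odd_generator n (eta I) =
    (if sum_list I = n \<and> I \<noteq> [] then 2 * ((-1) ^ weight n - (-1) ^ length I) else 0)"
proof -
  have "odd_generator n (eta I) =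
      (-1) ^ weight n * zetaQ (component n (eta I)) - conv_inverse zetaQ (component n (eta I))"
    by (simp add: odd_generator_def degree_part_def zetaQ_bar_component)
  moreover have "weight (0 :: 'a vec) = 0" by (simp add: weight_def)
  ultimately show ?thesis
    using zetaQ_eta[OF assms] conv_inverse_zetaQ_eta[OF assms] component_eta[OF assms, of n]
    by (cases "sum_list I = n"; cases "I = []")
      (auto simp: functional_simps(3)[OF functional_zetaQ] functional_simps(3)[OF functional_conv_inverse_zetaQ])
qed

lemma odd_generator_NSym: "odd_generator n \<in> carrier NSym"
  unfolding odd_generator_def by (rule odd_ideal_generator_NSym)

lemma weight_add: "weight (m + n) = weight m + weight n"
  by (simp add: weight_def sum.distrib)

lemma weight_pos: "n \<noteq> 0 \<Longrightarrow> 0 < weight n"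
  by (auto simp: weight_def fun_eq_iff intro: sum_pos2)

lemma even_weight_sum_list:
  "\<forall>i\<in>set I. odd (weight i) \<Longrightarrow> even (weight (sum_list I)) \<longleftrightarrow> even (length I)"
  by (induction I) (auto simp: weight_add, simp add: weight_def)

text \<open>A nonzero value means that |n| and len I differ in parity; if all parts had odd weight,
  the parities would agree.\<close>

lemma even_part_of_odd_generator:
  assumes "vcomp I" "odd_generator n (eta I) \<noteq> 0"
  obtains i where "i \<in> set I" "even (weight i)"
proof -
  have "sum_list I = n" "even (weight n) \<longleftrightarrow> odd (length I)"
    using assms(2) unfolding odd_generator_eta[OF assms(1)] by (auto split: if_splits simp: minus_one_power_iff)
  then show ?thesis using even_weight_sum_list[of I] that by blast
qed

lemma sum_list_split:
  fixes I :: "'l::finite vec list"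
  shows "I = A @ i # B \<Longrightarrow> sum_list I = i + sum_list (A @ B)"
  by (simp add: ac_simps)

lemma part_vle:
  fixes i :: "'l::finite vec"
  assumes "i \<in> set I" "sum_list I \<le>\<^sub>v k"
  shows "i \<le>\<^sub>v k"
proof -
  obtain A B where "I = A @ i # B" using assms(1) by (meson split_list)
  then have "i x \<le> sum_list I x" for x using sum_list_split[of I A i B] by simp
  then show ?thesis using assms(2) unfolding vle_def le_fun_def
    by (meson enat_ord_simps(1) order_trans)
qed

lemma part_weight_less:
  assumes "vcomp I" "i \<in> set I" "I \<noteq> [i]"
  shows "weight i < weight (sum_list I)"
proof -
  obtain A B where AB: "I = A @ i # B" using assms(2) by (meson split_list)
  then have "A @ B \<noteq> []" using assms(3) by auto
  moreover have "0 \<notin> set (A @ B)" using assms(1) AB by (auto simp: vcomp_def)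
  ultimately have "sum_list (A @ B) \<noteq> 0"
    unfolding sum_list_vec_zero by (metis list.set_sel(1))
  then show ?thesis using weight_pos[of "sum_list (A @ B)"] sum_list_split[OF AB] by (simp add: weight_add)
qed


section \<open>Ideals of NSym\<close>

text \<open>Nonzero parts bound the length by the weight of n, and each part lies in the finite box
  below n. Hence functionals of a single degree have finite expansions in the
  \<open>Upsilon I\<close>.\<close>

lemma finite_vcomps: "finite {I :: 'l::finite vec list. vcomp I \<and> sum_list I = n}"
proof -
  have len: "length I \<le> weight (sum_list I)" if "vcomp I" for I :: "'l vec list"
    using that
  proof (induction I)
    case (Cons i I)
    then have "0 < weight i" by (intro weight_pos) (auto simp: vcomp_def)
    then show ?case using Cons unfolding sum_list.Cons weight_add by (simp add: vcomp_def)
  qed simp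
  have le: "i \<in> {i. \<forall>x. i x \<le> n x}" if "i \<in> set I" "sum_list I = n" for i I
    using part_vle[OF that(1), of "\<lambda>x. enat (n x)"] that(2) by (simp add: vle_def le_fun_def)
  have "{i. \<forall>x. i x \<le> n x} \<subseteq> PiE UNIV (\<lambda>x. {..n x})" by auto
  then have "finite {i. \<forall>x. i x \<le> n x}" by (rule finite_subset) (intro finite_PiE; simp)
  from finite_lists_length_le[OF this, of "weight n"] show ?thesis
    by (rule rev_finite_subset) (use len le in blast)
qed

lemma functional_add: "functional f \<Longrightarrow> functional g \<Longrightarrow> functional (f + g)"
  by (intro functionalI) (simp_all add: functional_simps algebra_simps)

lemma functional_fscale: "functional f \<Longrightarrow> functional (fscale c f)"
  by (intro functionalI) (simp_all add: functional_simps fscale_def algebra_simps)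

lemma NSym_functional: "f \<in> carrier NSym \<Longrightarrow> functional f"
  by (simp add: NSym_iff)

lemma NSym_fscale:
  assumes "f \<in> carrier NSym"
  shows "fscale c f \<in> carrier NSym"
proof -
  have "{sum_list I | I. vcomp I \<and> fscale c f (M I) \<noteq> 0} \<subseteq> {sum_list I | I. vcomp I \<and> f (M I) \<noteq> 0}"
    by (auto simp: fscale_def)
  then show ?thesis using assms functional_fscale finite_subset unfolding NSym_iff by blast
qed

text \<open>Scaling is multiplication by a multiple of the unit, so every ring ideal of
  \<open>NSym\<close> is also a rational subspace.\<close>

lemma fscale_conv: "functional f \<Longrightarrow> fscale c f = conv (fscale c counit) f"
proof (rule functional_eqI[OF functional_fscale functional_conv])
  fix I :: "'a vec list" assume f: "functional f" and I: "vcomp I"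
  have "conv (fscale c counit) f (M I) = c * conv counit f (M I)"
    by (simp add: conv_M I fscale_def sum_distrib_left mult.assoc)
  then show "fscale c f (M I) = conv (fscale c counit) f (M I)"
    by (simp add: conv_counit(2)[OF f] fscale_def)
qed

section \<open>Membership criteria for an arbitrary two-sided ideal of NSym\<close>

context
  fixes A :: "('l::finite qsym \<Rightarrow> rat) set"
  assumes A: "ideal A NSym"
begin

lemma NSym_ideal_add: "f \<in> A \<Longrightarrow> g \<in> A \<Longrightarrow> f + g \<in> A"
  using additive_subgroup.a_closed[OF ideal.axioms(1)[OF A]] by (simp add: NSym_def)

lemma NSym_ideal_zero: "0 \<in> A"
  using additive_subgroup.zero_closed[OF ideal.axioms(1)[OF A]] by (simp add: NSym_def)

lemma NSym_ideal_carrier: "f \<in> A \<Longrightarrow> f \<in> carrier NSym"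
  using additive_subgroup.a_subset[OF ideal.axioms(1)[OF A]] by blast

lemma NSym_ideal_conv:
  "f \<in> A \<Longrightarrow> g \<in> carrier NSym \<Longrightarrow> conv f g \<in> A"
  "f \<in> A \<Longrightarrow> g \<in> carrier NSym \<Longrightarrow> conv g f \<in> A"
  using ideal.I_r_closed[OF A, of f g] ideal.I_l_closed[OF A, of f g] by (simp_all add: NSym_def)

lemma NSym_ideal_fscale: "f \<in> A \<Longrightarrow> fscale c f \<in> A"
proof -
  assume f: "f \<in> A"
  have "counit \<in> carrier (NSym :: ('l qsym \<Rightarrow> rat) ring)"
    using ring.ring_simprules(6)[OF ring_NSym] by (simp add: NSym_def)
  then have "conv (fscale c counit) f \<in> A" using f by (intro NSym_ideal_conv NSym_fscale)
  then show "fscale c f \<in> A" using fscale_conv NSym_functional NSym_ideal_carrier[OF f] by metis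
qed

text \<open>\<open>Upsilon I\<close> is a convolution product in which \<open>Upsilon [i]\<close> is
  one factor.\<close>

lemma Upsilon_in_ideal:
  assumes "vcomp I" "i \<in> set I" "Upsilon [i] \<in> A"
  shows "Upsilon I \<in> A"
proof -
  obtain B C where BC: "I = B @ i # C" using assms(2) by (meson split_list)
  then have v: "vcomp B" "vcomp [i]" "vcomp C" "vcomp ([i] @ C)" using assms(1) by (auto simp: vcomp_def)
  have "Upsilon I = conv (Upsilon B) (conv (Upsilon [i]) (Upsilon C))"
    using Upsilon_append[OF v(1,4)] Upsilon_append[OF v(2,3)] by (simp add: BC)
  then show ?thesis using assms(3) v by (simp add: NSym_ideal_conv Upsilon_NSym)
qed

text \<open>Such an f is the finite sum of f(\<open>eta I\<close>) \<open>Upsilon I\<close> over the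
  compositions I of n, and each term lies in A.\<close>

lemma homogeneous_in_ideal:
  assumes f: "functional f" and "\<And>I. vcomp I \<Longrightarrow> f (eta I) \<noteq> 0 \<Longrightarrow> sum_list I = n \<and> Upsilon I \<in> A"
  shows "f \<in> A"
proof -
  let ?N = "{I :: 'l vec list. vcomp I \<and> sum_list I = n}"
  have sum_A: "(\<Sum>I\<in>S. fscale (f (eta I)) (Upsilon I)) \<in> A" if "finite S" "S \<subseteq> ?N" for S
    using that
  proof (induction S rule: finite_induct)
    case (insert I S)
    have "fscale (f (eta I)) (Upsilon I) \<in> A"
    proof (cases "f (eta I) = 0")
      case True
      then have "fscale (f (eta I)) (Upsilon I) = 0" by (simp add: fscale_def fun_eq_iff)
      then show ?thesis by (simp only: NSym_ideal_zero)
    qed (use assms(2) insert.prems in \<open>auto intro: NSym_ideal_fscale\<close>)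
    then show ?case using insert unfolding sum.insert[OF insert.hyps] by (intro NSym_ideal_add) auto
  qed (simp add: NSym_ideal_zero)
  have "f = (\<Sum>I\<in>?N. fscale (f (eta I)) (Upsilon I))"
  proof (rule functional_eqI_eta[OF f])
    show "functional (\<Sum>I\<in>?N. fscale (f (eta I)) (Upsilon I))"
      using sum_A[OF finite_vcomps] NSym_ideal_carrier NSym_functional by blast
    fix J :: "'l vec list" assume J: "vcomp J"
    have "(\<Sum>I\<in>?N. fscale (f (eta I)) (Upsilon I)) (eta J) = (\<Sum>I\<in>?N. if I = J then f (eta J) else 0)"
      unfolding sum_function_apply by (intro sum.cong) (auto simp: fscale_def Upsilon_eta J)
    also have "\<dots> = f (eta J)"
      using assms(2)[OF J] J by (auto simp: sum.delta finite_vcomps)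
    finally show "f (eta J) = (\<Sum>I\<in>?N. fscale (f (eta I)) (Upsilon I)) (eta J)" by simp
  qed
  then show ?thesis using sum_A[OF finite_vcomps order_refl] by simp
qed

text \<open>Each \<open>Upsilon I\<close> occurring in the generator has a part of even weight, and
  that part is \<le> k because I sums to n.\<close>

lemma odd_generator_in_ideal:
  assumes "n \<le>\<^sub>v k" "\<And>i. 0 < i \<Longrightarrow> i \<le>\<^sub>v k \<Longrightarrow> even (weight i) \<Longrightarrow> Upsilon [i] \<in> A"
  shows "odd_generator n \<in> A"
proof (rule homogeneous_in_ideal[OF NSym_functional[OF odd_generator_NSym], of _ n])
  fix I :: "'l vec list" assume I: "vcomp I" "odd_generator n (eta I) \<noteq> 0"
  then have n: "sum_list I = n" by (auto simp: odd_generator_eta split: if_splits)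
  from I obtain i where i: "i \<in> set I" "even (weight i)" by (rule even_part_of_odd_generator)
  have "0 < i" using I(1) i(1) by (auto simp: vcomp_def less_le le_fun_def)
  then show "sum_list I = n \<and> Upsilon I \<in> A"
    using n i part_vle[OF i(1)] assms Upsilon_in_ideal[OF I(1) i(1)] by blast
qed

text \<open>The system is triangular: apart from the term of \<open>[n]\<close>, the generator of
  degree n involves only \<open>Upsilon I\<close> having an even part of smaller weight, which are
  in A by induction.\<close>

lemma Upsilon_single_in_ideal:
  assumes "0 < n" "n \<le>\<^sub>v k" "even (weight n)" "\<And>m. m \<le>\<^sub>v k \<Longrightarrow> odd_generator m \<in> A"
  shows "Upsilon [n] \<in> A"
  using assms(1-3)
proof (induction "weight n" arbitrary: n rule: less_induct)
  case less
  have vn: "vcomp [n]" using less.prems(1) by (auto simp: vcomp_def)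
  \<comment> \<open>For even |n| the coefficient of \<open>Upsilon [n]\<close> is 2 (1 - (-1)) = 4;
    it is removed here and divided out at the end.\<close>
  let ?f = "odd_generator n + fscale (-4) (Upsilon [n])"
  have "?f \<in> A"
  proof (rule homogeneous_in_ideal)
    show "functional ?f"
      by (intro functional_add functional_fscale functional_Upsilon NSym_functional odd_generator_NSym)
    fix I :: "'l vec list" assume I: "vcomp I" and nz: "?f (eta I) \<noteq> 0"
    have "odd_generator n (eta [n]) = 4"
      using less.prems(3) by (simp add: odd_generator_eta[OF vn])
    then have In: "I \<noteq> [n]" using nz by (auto simp: fscale_def Upsilon_eta vn)
    then have g: "odd_generator n (eta I) \<noteq> 0" using nz by (auto simp: fscale_def Upsilon_eta vn I)
    then have n: "sum_list I = n" by (auto simp: odd_generator_eta I split: if_splits)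
    from I g obtain i where i: "i \<in> set I" "even (weight i)" by (rule even_part_of_odd_generator)
    have "0 < i" using I i(1) by (auto simp: vcomp_def less_le le_fun_def)
    moreover have "i \<le>\<^sub>v k" using part_vle[OF i(1)] n less.prems(2) by simp
    moreover have "I \<noteq> [i]" using In n by auto
    then have "weight i < weight n" using part_weight_less[OF I i(1)] n by simp
    ultimately have "Upsilon [i] \<in> A" using less.hyps i(2) by blast
    then show "sum_list I = n \<and> Upsilon I \<in> A" using n Upsilon_in_ideal[OF I i(1)] by blast
  qed
  then have "fscale (1/4) (odd_generator n + fscale (-1) ?f) \<in> A"
    by (rule NSym_ideal_fscale[OF NSym_ideal_add[OF assms(4)[OF less.prems(2)] NSym_ideal_fscale]])
  moreover have "fscale (1/4) (odd_generator n + fscale (-1) ?f) = Upsilon [n]"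
    by (simp add: fscale_def fun_eq_iff)
  ultimately show ?case by (simp only:)
qed

end

lemma odd_ideal_eq:
  "odd_ideal k = genideal NSym {Upsilon [n] | n. 0 < n \<and> n \<le>\<^sub>v k \<and> even (weight n)}"
proof (rule equalityI)
  let ?U = "{Upsilon [n] | n. 0 < n \<and> n \<le>\<^sub>v k \<and> even (weight n)}"
  have odd: "odd_ideal k = genideal NSym {odd_generator n | n. n \<le>\<^sub>v k}"
    by (simp add: odd_ideal_def odd_generator_def)
  have gU: "?U \<subseteq> carrier NSym"
    by (auto intro!: Upsilon_NSym simp: vcomp_def)
  have gO: "{odd_generator n | n. n \<le>\<^sub>v k} \<subseteq> carrier NSym"
    using odd_generator_NSym by blast
  note gen = ring.genideal_ideal[OF ring_NSym] ring.genideal_minimal[OF ring_NSym] ring.genideal_self[OF ring_NSym]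
  show "odd_ideal k \<subseteq> genideal NSym ?U"
    unfolding odd
    by (rule gen(2)[OF gen(1)[OF gU]]) (use gen(3)[OF gU] in \<open>auto intro!: odd_generator_in_ideal[OF gen(1)[OF gU]]\<close>)
  show "genideal NSym ?U \<subseteq> odd_ideal k"
    unfolding odd
    by (rule gen(2)[OF gen(1)[OF gO]]) (use gen(3)[OF gO] in \<open>auto intro!: Upsilon_single_in_ideal[OF gen(1)[OF gO]]\<close>)
qed


section \<open>Annihilators of subcoalgebras\<close>

text \<open>The monomial placing I on the first len I variables occurs in \<open>M I\<close> with
  coefficient 1 and in no other \<open>M J\<close>. Coefficients in the \<open>M\<close> basis can
  thus be read off raw series.\<close>

lemma Rep_canonical: "vcomp I \<Longrightarrow> Rep_qsym h (mono_prod [0..<length I] I) = M_coeff I h"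
  using functional_eqI[OF functional_Rep functional_M_coeff, of "mono_prod [0..<length I] I" I]
  by (simp add: Rep_M_canonical M_coeff_M fun_eq_iff)

text \<open>A finite truncation of \<open>f \<otimes> g\<close> on series in two sets of variables. It is linear in the series and,
  for large \<open>X\<close>, equals the true value on any given element of \<open>QSym \<otimes> QSym\<close>.\<close>

definition tensor_eval ::
  "('l::finite qsym \<Rightarrow> rat) \<Rightarrow> ('l qsym \<Rightarrow> rat) \<Rightarrow> 'l vec list set \<Rightarrow> ('l monomial \<times> 'l monomial \<Rightarrow> rat) \<Rightarrow> rat"
  where "tensor_eval f g X F =
    (\<Sum>I\<in>X. \<Sum>J\<in>X. F (mono_prod [0..<length I] I, mono_prod [0..<length J] J) * (f (M I) * g (M J)))"

text \<open>Large finite sets of compositions; as a filter, finitely many thresholds combine without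
  being named.\<close>

abbreviation vcomp_filter :: "'l vec list set filter"
  where "vcomp_filter \<equiv> finite_subsets_at_top (Collect vcomp)"

lemma tensor_eval_linear:
  "tensor_eval f g X (F + G) = tensor_eval f g X F + tensor_eval f g X G"
  "tensor_eval f g X (fscale c F) = c * tensor_eval f g X F"
  "tensor_eval f g X 0 = 0"
  by (simp_all add: tensor_eval_def fscale_def algebra_simps sum.distrib sum_distrib_left)

lemma eventually_functional_sum:
  assumes "functional f"
  shows "\<forall>\<^sub>F X in vcomp_filter. (\<Sum>I\<in>X. M_coeff I h * f (M I)) = f h"
  unfolding eventually_finite_subsets_at_top
proof (intro exI[of _ "{I. vcomp I \<and> M_coeff I h \<noteq> 0}"] conjI allI impI)
  fix X :: "'a vec list set"
  assume X: "finite X \<and> {I. vcomp I \<and> M_coeff I h \<noteq> 0} \<subseteq> X \<and> X \<subseteq> Collect vcomp"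
  have "f h = (\<Sum>I | vcomp I \<and> M_coeff I h \<noteq> 0. M_coeff I h * f (M I))"
    by (subst M_expansion[of h]) (simp add: functional_simps[OF assms])
  also have "\<dots> = (\<Sum>I\<in>X. M_coeff I h * f (M I))"
    using X by (intro sum.mono_neutral_left) auto
  finally show "(\<Sum>I\<in>X. M_coeff I h * f (M I)) = f h" by simp
qed (auto simp: finite_M_coeff)

lemma eventually_tensor_eval_tensor:
  assumes "functional f" "functional g"
  shows "\<forall>\<^sub>F X in vcomp_filter. tensor_eval f g X (tensor a b) = f a * g b"
proof -
  have sub: "\<forall>\<^sub>F X in vcomp_filter. X \<subseteq> Collect vcomp"
    by (auto simp: eventually_finite_subsets_at_top)
  show ?thesis
    using eventually_functional_sum[OF assms(1), of a] eventually_functional_sum[OF assms(2), of b] sub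
  proof eventually_elim
    case (elim X)
    have "tensor_eval f g X (tensor a b) = (\<Sum>I\<in>X. \<Sum>J\<in>X. (M_coeff I a * f (M I)) * (M_coeff J b * g (M J)))"
      unfolding tensor_eval_def tensor_def
      using elim(3) by (intro sum.cong refl) (auto simp: Rep_canonical subset_iff)
    then show ?case using elim(1,2) by (simp flip: sum_product)
  qed
qed

text \<open>By linearity it suffices to treat \<open>M I\<close>, whose coproduct is a finite sum of
  pure tensors, each with its own threshold.\<close>

lemma eventually_tensor_eval_comult:
  assumes "functional f" "functional g"
  shows "\<forall>\<^sub>F X in vcomp_filter. tensor_eval f g X (comult h) = conv f g h"
proof -
  have "h \<in> qs.span (M ` Collect vcomp)" by (simp add: span_M)
  then show ?thesis
  proof (induction rule: qs.span_induct_alt)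
    case base
    show ?case by (simp only: comult_zero tensor_eval_linear functional_simps[OF functional_conv] simp_thms eventually_True)
  next
    case (step c x y)
    then obtain I where I: "x = M I" "vcomp I" by auto
    have cM: "comult (M I) = (\<Sum>r\<le>length I. tensor (M (take r I)) (M (drop r I)))"
      by (simp add: fun_eq_iff comult_def M_extend_M I sum_function_apply)
    have te_sum: "tensor_eval f g X (sum F R) = (\<Sum>r\<in>R. tensor_eval f g X (F r))" for X F and R :: "nat set"
      by (induction R rule: infinite_finite_induct) (simp_all only: sum.infinite sum.empty sum.insert tensor_eval_linear not_False_eq_True)
    have "\<forall>\<^sub>F X in vcomp_filter. \<forall>r\<in>{..length I}.
        tensor_eval f g X (tensor (M (take r I)) (M (drop r I))) = f (M (take r I)) * g (M (drop r I))"
      by (intro eventually_ball_finite ballI eventually_tensor_eval_tensor assms) simp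
    with step(2) show ?case
    proof eventually_elim
      case (elim X)
      then show ?case
        unfolding comult_add comult_scale tensor_eval_linear functional_simps[OF functional_conv]
          I(1) cM conv_M[OF I(2)] te_sum by simp
    qed
  qed
qed

text \<open>The coproduct of h is a combination of tensors over C, each killed in one factor. The
  truncations of f \<otimes> g on it are therefore eventually 0, and they are also eventually
  \<open>conv f g h\<close>.\<close>

lemma conv_annihilates:
  assumes C: "graded_subcoalgebra C" "h \<in> C" and fg: "functional f" "functional g"
    and ann: "(\<forall>x\<in>C. f x = 0) \<or> (\<forall>x\<in>C. g x = 0)"
  shows "conv f g h = 0"
proof -
  have "comult h \<in> fs.span {tensor a b | a b. a \<in> C \<and> b \<in> C}"
    using C by (simp add: graded_subcoalgebra_def)
  then have "\<forall>\<^sub>F X in vcomp_filter. tensor_eval f g X (comult h) = 0"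
  proof (induction rule: fs.span_induct_alt)
    case base
    show ?case by (simp only: tensor_eval_linear simp_thms eventually_True)
  next
    case (step c x y)
    then obtain a b where ab: "x = tensor a b" "a \<in> C" "b \<in> C" by auto
    show ?case
      using step(2) eventually_tensor_eval_tensor[OF fg, of a b]
    proof eventually_elim
      case (elim X)
      then show ?case using ann ab unfolding ab(1) tensor_eval_linear by auto
    qed
  qed
  with eventually_tensor_eval_comult[OF fg, of h]
  have "\<forall>\<^sub>F X :: 'a vec list set in vcomp_filter. conv f g h = 0" by eventually_elim simp
  \<comment> \<open>The filter is proper, so a constant statement that holds eventually is
    true.\<close>
  then show ?thesis by (simp add: eventually_const)
qed

lemma ideal_annihilator:
  assumes "graded_subcoalgebra C"
  shows "ideal {f \<in> carrier NSym. \<forall>x\<in>C. f x = 0} NSym" (is "ideal ?A NSym")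
proof (rule idealI)
  interpret N: ring "NSym :: ('a qsym \<Rightarrow> rat) ring" by (rule ring_NSym)
  have c: "f + g \<in> carrier NSym" "conv f g \<in> carrier NSym"
    if "f \<in> carrier NSym" "g \<in> carrier NSym" for f g :: "'a qsym \<Rightarrow> rat"
    using that N.add.m_closed[of f g] N.m_closed[of f g] by (simp_all add: NSym_def)
  show "ring (NSym :: ('a qsym \<Rightarrow> rat) ring)" by (rule ring_NSym)
  show "subgroup ?A (add_monoid NSym)"
  proof (rule N.add.subgroupI)
    show "?A \<noteq> {}" using N.zero_closed by (auto simp: NSym_def)
    fix f assume f: "f \<in> ?A"
    have m: "fscale (-1) f \<in> carrier NSym" using f by (intro NSym_fscale) simp
    \<comment> \<open>The abstract ring negative is identified with the pointwise one by uniqueness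
      of inverses.\<close>
    have "fscale (-1) f \<oplus>\<^bsub>NSym\<^esub> f = \<zero>\<^bsub>NSym\<^esub>" by (simp add: NSym_def fscale_def fun_eq_iff)
    then have "\<ominus>\<^bsub>NSym\<^esub> f = fscale (-1) f" using m f by (intro N.minus_equality) auto
    then show "\<ominus>\<^bsub>NSym\<^esub> f \<in> ?A" using m f by (simp add: fscale_def)
  next
    fix f g assume "f \<in> ?A" "g \<in> ?A"
    then show "f \<oplus>\<^bsub>NSym\<^esub> g \<in> ?A" using c(1)[of f g] by (simp add: NSym_def)
  qed auto
  fix f g :: "'a qsym \<Rightarrow> rat" assume fg: "f \<in> ?A" "g \<in> carrier NSym"
  then have "conv f g \<in> ?A" "conv g f \<in> ?A"
    using conv_annihilates[OF assms] NSym_functional c(2) by auto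
  then show "g \<otimes>\<^bsub>NSym\<^esub> f \<in> ?A" "f \<otimes>\<^bsub>NSym\<^esub> g \<in> ?A" by (simp_all add: NSym_def)
qed


section \<open>The odd coalgebra\<close>

definition odd_vcomp :: "('l::finite \<Rightarrow> enat) \<Rightarrow> 'l vec list \<Rightarrow> bool"
  where "odd_vcomp k I \<longleftrightarrow> vcomp I \<and> (\<forall>i\<in>set I. i \<le>\<^sub>v k \<longrightarrow> odd (weight i))"

text \<open>The annihilator of C is an ideal containing the odd generators, hence every
  \<open>Upsilon I\<close> with a forbidden part. Elements of C thus have zero coordinate at each
  such \<open>eta I\<close>.\<close>

lemma odd_subcoalgebra_subset:
  assumes "odd_subcoalgebra k C"
  shows "C \<subseteq> qs.span {eta I | I. odd_vcomp k I}"
proof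
  have C: "graded_subcoalgebra C" using assms by (simp add: odd_subcoalgebra_def)
  let ?A = "{f \<in> carrier NSym. \<forall>x\<in>C. f x = 0}"
  have gen: "odd_generator n \<in> ?A" if n: "n \<le>\<^sub>v k" for n
  proof -
    have "odd_generator n x = 0" if "x \<in> C" for x
    proof -
      \<comment> \<open>The generator sees only the degree n component of x, which stays in C
        because C is graded.\<close>
      have "component n x \<in> C" "homogeneous n (component n x)"
        using C that by (auto simp: graded_subcoalgebra_def homogeneous_def component_component)
      then show ?thesis using assms n
        by (auto simp: odd_subcoalgebra_def odd_generator_def degree_part_def)
    qed
    then show ?thesis using odd_generator_NSym by blast
  qed
  have bad: "Upsilon I x = 0" if xI: "x \<in> C" "vcomp I" "\<not> odd_vcomp k I" for I x
  proof -
    obtain i where i: "i \<in> set I" "i \<le>\<^sub>v k" "even (weight i)" using xI(2,3) by (auto simp: odd_vcomp_def)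
    have "0 < i" using xI(2) i(1) by (auto simp: vcomp_def less_le le_fun_def)
    from Upsilon_single_in_ideal[OF ideal_annihilator[OF C] this i(2,3) gen]
    have "Upsilon I \<in> ?A" by (rule Upsilon_in_ideal[OF ideal_annihilator[OF C] xI(2) i(1)])
    then show ?thesis using xI(1) by blast
  qed
  fix h assume h: "h \<in> C"
  let ?R = "qs.representation (eta ` Collect vcomp) h"
  have "h = (\<Sum>b | ?R b \<noteq> 0. qscale (?R b) b)"
    using qs.sum_nonzero_representation_eq[OF independent_eta, of h] by (simp add: span_eta)
  also have "\<dots> \<in> qs.span {eta I | I. odd_vcomp k I}"
  proof (intro qs.span_sum qs.span_scale)
    fix b assume b: "b \<in> {b. ?R b \<noteq> 0}"
    then obtain I where I: "b = eta I" "vcomp I"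
      using qs.representation_ne_zero[of "eta ` Collect vcomp" h b] by auto
    then have "odd_vcomp k I" using bad[OF h I(2)] b by (auto simp: Upsilon_def)
    then show "b \<in> qs.span {eta I | I. odd_vcomp k I}" using I by (intro qs.span_base) auto
  qed
  finally show "h \<in> qs.span {eta I | I. odd_vcomp k I}" .
qed

lemma odd_generator_odd_vcomp:
  assumes "odd_vcomp k I" "n \<le>\<^sub>v k"
  shows "odd_generator n (eta I) = 0"
proof (rule ccontr)
  assume nz: "odd_generator n (eta I) \<noteq> 0"
  have I: "vcomp I" using assms(1) by (simp add: odd_vcomp_def)
  have "sum_list I = n" using nz by (auto simp: odd_generator_eta I split: if_splits)
  moreover obtain i where "i \<in> set I" "even (weight i)" using even_part_of_odd_generator[OF I nz] .
  ultimately show False using part_vle[of i I k] assms by (auto simp: odd_vcomp_def)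
qed

text \<open>The condition on parts passes to prefixes and suffixes, so deconcatenation stays inside
  the span; each \<open>eta I\<close> is homogeneous, so the span is graded.\<close>

lemma odd_subcoalgebra_span:
  "odd_subcoalgebra k (qs.span {eta I | I. odd_vcomp k I})" (is "odd_subcoalgebra k ?C")
  unfolding odd_subcoalgebra_def graded_subcoalgebra_def
proof (intro conjI ballI allI impI)
  show "qs.subspace ?C" by simp
  fix h assume h: "h \<in> ?C"
  show "component n h \<in> ?C" for n
    using h
  proof (induction rule: qs.span_induct_alt)
    case (step c x y)
    then obtain I where I: "x = eta I" "odd_vcomp k I" by auto
    then have "component n x = eta I \<or> component n x = 0" by (auto simp: component_eta odd_vcomp_def)
    moreover have "eta I \<in> ?C" using I by (intro qs.span_base) auto
    ultimately have "component n x \<in> ?C" by (elim disjE) (simp_all only: qs.span_zero)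
    then show ?case using step(2) unfolding component_add component_scale
      by (intro qs.span_add qs.span_scale)
  qed (simp add: component_zero qs.span_zero)
  show "comult h \<in> fs.span {tensor f g | f g. f \<in> ?C \<and> g \<in> ?C}"
    using h
  proof (induction rule: qs.span_induct_alt)
    case base
    show ?case unfolding comult_zero by (rule fs.span_zero)
  next
    case (step c x y)
    then obtain I where I: "x = eta I" "odd_vcomp k I" by auto
    have "odd_vcomp k (take r I)" "odd_vcomp k (drop r I)" for r
      using I(2) by (auto simp: odd_vcomp_def vcomp_take vcomp_drop dest: in_set_takeD in_set_dropD)
    then have "eta (take r I) \<in> ?C" "eta (drop r I) \<in> ?C" for r
      by (auto intro: qs.span_base)
    then have "comult x \<in> fs.span {tensor f g | f g. f \<in> ?C \<and> g \<in> ?C}"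
      using I unfolding I(1) 
      by (subst comult_eta, simp add: odd_vcomp_def) (intro fs.span_sum fs.span_base, blast)
    then show ?case using step(2) unfolding comult_add comult_scale
      by (intro fs.span_add fs.span_scale)
  qed
  fix n assume n: "n \<le>\<^sub>v k \<and> homogeneous n h"
  \<comment> \<open>On h homogeneous of degree n this value is the difference of the two characters
    to be compared.\<close>
  have "odd_generator n h = 0"
    using h
  proof (induction rule: qs.span_induct_alt)
    case (step c x y)
    then show ?case using odd_generator_odd_vcomp n
      by (auto simp: functional_simps[OF NSym_functional[OF odd_generator_NSym]])
  qed (simp add: functional_simps[OF NSym_functional[OF odd_generator_NSym]])
  then show "zetaQ_bar h = conv_inverse zetaQ h"
    using n by (simp add: odd_generator_def degree_part_def homogeneous_def)
qed

theorem theorem5p18: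
  fixes k :: "'l::finite \<Rightarrow> enat"
  shows "odd_ideal k = genideal NSym {Upsilon [n] | n. 0 < n \<and> n \<le>\<^sub>v k \<and> even (weight n)} \<and>
    odd_coalgebra k =
      qs.span {eta I | I. vcomp I \<and> (\<forall>i\<in>set I. i \<le>\<^sub>v k \<longrightarrow> odd (weight i))}"
proof
  have "odd_coalgebra k = qs.span {eta I | I. odd_vcomp k I}"
    using odd_subcoalgebra_subset[OF odd_coalgebra_greatest(1)]
      odd_coalgebra_greatest(2)[OF odd_subcoalgebra_span] by (rule equalityI)
  then show "odd_coalgebra k =
      qs.span {eta I | I. vcomp I \<and> (\<forall>i\<in>set I. i \<le>\<^sub>v k \<longrightarrow> odd (weight i))}"
    by (simp add: odd_vcomp_def)
qed (rule odd_ideal_eq)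

end
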